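(* Let $n\ge1$, $p\in\{0,1,2,\dots\}\cup\{+\infty\}$, let $\gamma_1,\dots,\gamma_n:\mathbb{T}\to\mathbb{C}$ be locally injective $C^p$ curves and let $\gamma=\gamma_1\times\cdots\times\gamma_n:\mathbb{T}^n\to\mathbb{C}^n$. Then for every fixed point of $\gamma(\mathbb{T}^n)$, the set of functions in $C^p(\gamma)$ that are not holomorphically extendable at that point is a dense $G_\delta$ subset of $C^p(\gamma)$; likewise, the set of functions in $C^p(\gamma)$ that are holomorphically extendable at no point of $\gamma(\mathbb{T}^n)$ is a dense $G_\delta$ subset of $C^p(\gamma)$.
   Context: $\mathbb{T}$ is the unit circle in $\mathbb{C}$. $C^p(\mathbb{T}^n)$ is the space of functions $g:\mathbb{T}^n\to\mathbb{C}$ whose derivatives $\frac{\partial^{\alpha}g}{\partial\theta^{\alpha}}(e^{i\theta_1},\dots,e^{i\theta_n})$ with respect to $\theta_1,\dots,\theta_n$ exist and are continuous on $\mathbb{T}^n$ for all multi-indices $|\alpha|\le p$ (all $\alpha$ if $p=+\infty$). A curve $\gamma_i$ is $C^p$ if $\gamma_i\in C^p(\mathbb{T})$. $C^p(\gamma)$ is the space of functions $f:\gamma(\mathbb{T}^n)\to\mathbb{C}$ such that $f\circ\gamma\in C^p(\mathbb{T}^n)$, with the topology given by the seminorms $|f|_\alpha=\sup_{\theta_i\in\mathbb{R}}\left|\frac{\partial^{\alpha}(f\circ\gamma)}{\partial\theta^{\alpha}}(e^{i\theta_1},\dots,e^{i\theta_n})\right|$, $|\alpha|\le p$. A function $f:\gamma(\mathbb{T}^n)\to\mathbb{C}$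 is holomorphically extendable at a point of $\gamma(\mathbb{T}^n)$ if there are an open neighborhood $U\subseteq\mathbb{C}^n$ of that point and a holomorphic function $F:U\to\mathbb{C}$ with $F=f$ on $U\cap\gamma(\mathbb{T}^n)$. *)

theory Defs
  imports "HOL-Analysis.Analysis" "HOL-Library.Extended_Nat"
begin

definition partial_deriv :: "'a::euclidean_space \<Rightarrow> ('a \<Rightarrow> complex) \<Rightarrow> 'a \<Rightarrow> complex" where
  "partial_deriv b h x = vector_derivative (\<lambda>t. h (x + t *\<^sub>R b)) (at 0)"

text \<open>A multi-index is encoded as a word of basis vectors: the word \<open>[b\<^sub>1, \<dots>, b\<^sub>k]\<close> stands for
  \<open>\<partial>\<^sup>k / \<partial>b\<^sub>1 \<dots> \<partial>b\<^sub>k\<close> and its length is the order. For functions of class \<open>C\<^sup>p\<close> the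
  order of the letters is irrelevant.\<close>

definition iter_partial :: "'a::euclidean_space list \<Rightarrow> ('a \<Rightarrow> complex) \<Rightarrow> 'a \<Rightarrow> complex" where
  "iter_partial w h = foldr partial_deriv w h"

text \<open>The first conjunct is existence of the derivatives; it is needed because \<^const>\<open>vector_derivative\<close>
  is a total function.\<close>

definition C_class :: "enat \<Rightarrow> ('a::euclidean_space \<Rightarrow> complex) \<Rightarrow> bool" where
  "C_class p h \<longleftrightarrow>
     (\<forall>w\<in>lists Basis. \<forall>b\<in>Basis. enat (length (b # w)) \<le> p \<longrightarrow>
        (\<forall>x. (\<lambda>t. iter_partial w h (x + t *\<^sub>R b)) differentiable (at 0))) \<and>
     (\<forall>w\<in>lists Basis. enat (length w) \<le> p \<longrightarrow> continuous_on UNIV (iter_partial w h))"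

definition torus :: "(complex ^ 'n) set" where
  "torus = {z. \<forall>i. z $ i \<in> sphere 0 1}"

definition torus_exp :: "real ^ 'n \<Rightarrow> complex ^ 'n" where
  "torus_exp \<theta> = (\<chi> i. cis (\<theta> $ i))"

definition C_circle :: "enat \<Rightarrow> (complex \<Rightarrow> complex) \<Rightarrow> bool" where
  "C_circle p c \<longleftrightarrow> C_class p (\<lambda>t::real. c (cis t))"

definition C_torus :: "enat \<Rightarrow> (complex ^ 'n \<Rightarrow> complex) \<Rightarrow> bool" where
  "C_torus p g \<longleftrightarrow> C_class p (\<lambda>\<theta>. g (torus_exp \<theta>))"

definition locally_injective_on :: "'a::topological_space set \<Rightarrow> ('a \<Rightarrow> 'b) \<Rightarrow> bool" where
  "locally_injective_on S c \<longleftrightarrow> (\<forall>x\<in>S. \<exists>U. open U \<and> x \<in> U \<and> inj_on c (U \<inter> S))"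

definition prod_curve :: "('n \<Rightarrow> complex \<Rightarrow> complex) \<Rightarrow> complex ^ 'n \<Rightarrow> complex ^ 'n" where
  "prod_curve \<gamma> z = (\<chi> i. \<gamma> i (z $ i))"

definition curve_image :: "('n \<Rightarrow> complex \<Rightarrow> complex) \<Rightarrow> (complex ^ 'n) set" where
  "curve_image \<gamma> = prod_curve \<gamma> ` torus"

text \<open>Functions with domain \<open>\<gamma>(\<T>\<^sup>n)\<close> are represented by total functions that are
  \<^const>\<open>undefined\<close> outside it, so that equality is equality on \<open>\<gamma>(\<T>\<^sup>n)\<close>.\<close>

definition C_space :: "enat \<Rightarrow> ('n::finite \<Rightarrow> complex \<Rightarrow> complex) \<Rightarrow> (complex ^ 'n \<Rightarrow> complex) set" where
  "C_space p \<gamma> = {f \<in> extensional (curve_image \<gamma>). C_torus p (f \<circ> prod_curve \<gamma>)}"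

definition C_seminorm ::
    "('n::finite \<Rightarrow> complex \<Rightarrow> complex) \<Rightarrow> (real ^ 'n) list \<Rightarrow> (complex ^ 'n \<Rightarrow> complex) \<Rightarrow> real" where
  "C_seminorm \<gamma> w f = (SUP \<theta>. cmod (iter_partial w (\<lambda>\<theta>. f (prod_curve \<gamma> (torus_exp \<theta>))) \<theta>))"

definition C_topology ::
    "enat \<Rightarrow> ('n::finite \<Rightarrow> complex \<Rightarrow> complex) \<Rightarrow> (complex ^ 'n \<Rightarrow> complex) topology" where
  "C_topology p \<gamma> = topology_generated_by
     {{g \<in> C_space p \<gamma>. C_seminorm \<gamma> w (\<lambda>z. g z - f z) < \<epsilon>} | f w \<epsilon>.
        f \<in> C_space p \<gamma> \<and> w \<in> lists Basis \<and> enat (length w) \<le> p \<and> 0 < \<epsilon>}"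

text \<open>Holomorphy in several variables: the Frechet derivative exists and is complex linear.\<close>

definition holomorphic_cn_on :: "(complex ^ 'n::finite \<Rightarrow> complex) \<Rightarrow> (complex ^ 'n) set \<Rightarrow> bool" where
  "holomorphic_cn_on F U \<longleftrightarrow>
     (\<forall>z\<in>U. \<exists>D. (F has_derivative D) (at z) \<and> (\<forall>c v. D (c *s v) = c * D v))"

definition hol_extendable_at ::
    "(complex ^ 'n::finite) set \<Rightarrow> (complex ^ 'n \<Rightarrow> complex) \<Rightarrow> complex ^ 'n \<Rightarrow> bool" where
  "hol_extendable_at K f z \<longleftrightarrow>
     (\<exists>U F. open U \<and> z \<in> U \<and> holomorphic_cn_on F U \<and> (\<forall>u\<in>U \<inter> K. F u = f u))"

definition dense_gdelta_in :: "'a topology \<Rightarrow> 'a set \<Rightarrow> bool" where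
  "dense_gdelta_in X S \<longleftrightarrow> gdelta_in X S \<and> X closure_of S = topspace X"

lemma iter_partial_zero: "iter_partial w (\<lambda>_. 0) = (\<lambda>_. 0)"
  by (induction w) (auto simp: iter_partial_def partial_deriv_def fun_eq_iff)

lemma topspace_C_topology: "topspace (C_topology p \<gamma>) = C_space p \<gamma>"
proof -
  have "f \<in> {g \<in> C_space p \<gamma>. C_seminorm \<gamma> [] (\<lambda>z. g z - f z) < 1}" if "f \<in> C_space p \<gamma>" for f
    using that by (simp add: C_seminorm_def iter_partial_zero)
  moreover have "[] \<in> lists Basis" "enat (length []) \<le> p" "(0::real) < 1"
    by (simp_all add: zero_enat_def[symmetric])
  ultimately have "C_space p \<gamma> \<subseteq> topspace (C_topology p \<gamma>)"
    unfolding C_topology_def topology_generated_by_topspace by blast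
  then show ?thesis
    unfolding C_topology_def topology_generated_by_topspace by blast
qed

end

theory Submission imports Defs "HOL-Complex_Analysis.Great_Picard"
begin

text \<open>
  The proof is a Baire category argument. Write \<open>K\<close> for the image of the product curve and fix
  \<open>z \<in> K\<close>.

  \<^emph>\<open>The space is completely metrizable.\<close> Sending a function to the family of all its derivatives of
  order at most \<open>p\<close> embeds \<open>C\<^sup>p(\<gamma>)\<close> into a countable product of Banach spaces of bounded continuous
  functions: the seminorm distances are exactly the distances of the coordinates, and the image is
  closed because a uniform limit of derivatives is the derivative of the limit
  (\<open>closedin_jets_image\<close>). So Baire's theorem holds (\<open>completely_metrizable_C_topology\<close>).

  \<^emph>\<open>Extendable functions form a countable union of closed sets.\<close> A function is extendable at \<open>z\<close> iff
  for some \<open>k\<close> it has a holomorphic extension to the ball of radius \<open>1/k\<close> around \<open>z\<close> that is bounded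
  by \<open>k\<close>. A Montel argument (\<open>Montel_cn\<close>) shows that limits of such functions have an extension with
  the same bound on the ball of half the radius. So the extendable functions are the union of the
  closures of these sets, and these closures stay inside sets of the same kind.

  \<^emph>\<open>Each of these sets has empty interior.\<close> Suppose that \<open>f\<close> is an interior point. A locally injective
  curve has empty interior in the plane, hence there is \<open>w\<close> off the \<open>i\<close>-th curve but as close to \<open>z\<^sub>i\<close> as
  desired. The function \<open>1 / (u\<^sub>i - w)\<close> belongs to \<open>C\<^sup>p(\<gamma>)\<close>, so that \<open>f + a / (u\<^sub>i - w)\<close> is again in the
  set for small \<open>a \<noteq> 0\<close>. Restrict both extensions to the complex line through \<open>z\<close> in direction \<open>i\<close>:
  their difference times \<open>\<zeta> - w\<close> equals \<open>a\<close> at the points of the \<open>i\<close>-th curve near \<open>z\<^sub>i\<close>, and these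
  accumulate at \<open>z\<^sub>i\<close> by local injectivity. The identity theorem in one variable makes the product
  equal to \<open>a\<close> on the whole disc, but at \<open>w\<close> it vanishes (\<open>no_extension_of_pole\<close>). Working on one line
  avoids a uniqueness theorem in several variables.

  For the functions that are extendable at no point, it suffices to avoid extendability at the
  points of a countable dense subset of \<open>K\<close>, because extendability is an open condition on the point.
\<close>

section \<open>Calculus of functions of class \<open>C\<^sup>p\<close>\<close>

lemma iter_partial_Nil [simp]: "iter_partial [] h = h"
  by (simp add: iter_partial_def)

lemma iter_partial_Cons: "iter_partial (b # w) h = partial_deriv b (iter_partial w h)"
  by (simp add: iter_partial_def)

lemma iter_partial_snoc: "iter_partial (w @ [b]) h = iter_partial w (partial_deriv b h)"
  by (simp add: iter_partial_def)

lemma partial_deriv_eqI: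
  assumes "((\<lambda>t. h (x + t *\<^sub>R b)) has_vector_derivative d) (at 0)"
  shows "partial_deriv b h x = d"
  unfolding partial_deriv_def using assms by (rule vector_derivative_at)

lemma has_vector_derivative_along_line:
  assumes "\<And>x. (\<lambda>t. h (x + t *\<^sub>R b)) differentiable (at 0)"
  shows "((\<lambda>t. h (x + t *\<^sub>R b)) has_vector_derivative partial_deriv b h (x + s *\<^sub>R b)) (at s)"
proof -
  have "((\<lambda>t. h ((x + s *\<^sub>R b) + t *\<^sub>R b)) has_vector_derivative partial_deriv b h (x + s *\<^sub>R b))
      (at 0)"
    unfolding partial_deriv_def using assms vector_derivative_works by blast
  then have "(((\<lambda>t. h (x + t *\<^sub>R b)) \<circ> (\<lambda>t. s + t)) has_vector_derivative
      partial_deriv b h (x + s *\<^sub>R b)) (at 0)"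
    by (simp add: o_def algebra_simps)
  then show ?thesis
    by (simp add: has_vector_derivative_def has_derivative_at o_def LIM_offset_zero_iff[where a=s])
qed

lemma has_partial_deriv:
  assumes "(\<lambda>t. h (x + t *\<^sub>R b)) differentiable (at 0)"
  shows "((\<lambda>t. h (x + t *\<^sub>R b)) has_vector_derivative partial_deriv b h x) (at 0)"
  unfolding partial_deriv_def using assms vector_derivative_works by blast

lemma C_class_0: "C_class (enat 0) h \<longleftrightarrow> continuous_on UNIV h"
  by (auto simp: C_class_def)

text \<open>This recursion replaces the quantification over all multi-indices by induction on the order, which
  is how the closure properties below are proved.\<close>

lemma C_class_Suc:
  "C_class (enat (Suc n)) h \<longleftrightarrow> continuous_on UNIV h \<and>
     (\<forall>b\<in>Basis. (\<forall>x. (\<lambda>t. h (x + t *\<^sub>R b)) differentiable (at 0)) \<and>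
        C_class (enat n) (partial_deriv b h))"  (is "?L \<longleftrightarrow> ?R")
proof
  assume L: ?L
  have d: "(\<lambda>t. iter_partial w h (x + t *\<^sub>R b)) differentiable (at 0)"
    if "w \<in> lists Basis" "b \<in> Basis" "length w \<le> n" for w b x
    using L that unfolding C_class_def by auto
  have c: "continuous_on UNIV (iter_partial w h)" if "w \<in> lists Basis" "length w \<le> Suc n" for w
    using L that unfolding C_class_def by auto
  show ?R
  proof (intro conjI ballI allI)
    show "continuous_on UNIV h" using c[of "[]"] by simp
    fix b :: 'a assume b: "b \<in> Basis"
    show "(\<lambda>t. h (x + t *\<^sub>R b)) differentiable (at 0)" for x using d[of "[]" b] b by simp
    show "C_class (enat n) (partial_deriv b h)"
      unfolding C_class_def iter_partial_snoc[symmetric]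
      using d[of "_ @ [b]"] c[of "_ @ [b]"] b by auto
  qed
next
  assume R: ?R
  show ?L
    unfolding C_class_def
  proof (intro conjI ballI impI allI)
    fix w :: "'a list" and b x assume w: "w \<in> lists Basis" "b \<in> Basis" "enat (length (b # w)) \<le> enat (Suc n)"
    show "(\<lambda>t. iter_partial w h (x + t *\<^sub>R b)) differentiable (at 0)"
    proof (cases w rule: rev_cases)
      case Nil
      then show ?thesis using R w by simp
    next
      case (snoc v a)
      then show ?thesis using R w by (auto simp: C_class_def iter_partial_snoc)
    qed
  next
    fix w :: "'a list" assume w: "w \<in> lists Basis" "enat (length w) \<le> enat (Suc n)"
    show "continuous_on UNIV (iter_partial w h)"
    proof (cases w rule: rev_cases)
      case Nil
      then show ?thesis using R w by simp
    next
      case (snoc v a)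
      then show ?thesis using R w by (auto simp: C_class_def iter_partial_snoc)
    qed
  qed
qed

text \<open>Reduces the smooth case to the finite orders, where induction is available.\<close>

lemma C_class_iff_finite_orders: "C_class p h \<longleftrightarrow> (\<forall>n. enat n \<le> p \<longrightarrow> C_class (enat n) h)"
  unfolding C_class_def
  by (meson enat_ord_simps(1) order.trans order_refl)

lemma C_class_mono: "C_class p h \<Longrightarrow> q \<le> p \<Longrightarrow> C_class q h"
  by (meson C_class_iff_finite_orders order.trans)

lemma C_class_continuous: "C_class p h \<Longrightarrow> continuous_on UNIV h"
  using C_class_0[of h] C_class_mono[of p h "enat 0"] by (simp add: zero_enat_def[symmetric])

lemma C_class_differentiable:
  assumes "C_class p h" "w \<in> lists Basis" "b \<in> Basis" "enat (Suc (length w)) \<le> p"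
  shows "(\<lambda>t. iter_partial w h (x + t *\<^sub>R b)) differentiable (at 0)"
  using assms unfolding C_class_def by simp

lemma C_class_const: "C_class (enat n) (\<lambda>_. c)"
proof (induction n arbitrary: c)
  case (Suc n)
  have "partial_deriv b (\<lambda>_. c) = (\<lambda>_. 0)" for b :: 'a
    by (auto intro!: partial_deriv_eqI)
  with Suc show ?case by (auto simp: C_class_Suc)
qed (auto simp: C_class_0)

lemma C_class_add:
  assumes "C_class (enat n) f" "C_class (enat n) g"
  shows "C_class (enat n) (\<lambda>x. f x + g x)"
  using assms
proof (induction n arbitrary: f g)
  case (Suc n)
  have "partial_deriv b (\<lambda>x. f x + g x) = (\<lambda>x. partial_deriv b f x + partial_deriv b g x)"
    if "b \<in> Basis" for b
    using Suc.prems that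
    by (intro ext partial_deriv_eqI has_vector_derivative_add has_partial_deriv) (auto simp: C_class_Suc)
  with Suc show ?case by (auto simp: C_class_Suc intro!: continuous_intros)
qed (auto simp: C_class_0 intro!: continuous_intros)

lemma C_class_mult:
  assumes "C_class (enat n) f" "C_class (enat n) g"
  shows "C_class (enat n) (\<lambda>x. f x * g x)"
  using assms
proof (induction n arbitrary: f g)
  case (Suc n)
  have "partial_deriv b (\<lambda>x. f x * g x) = (\<lambda>x. f x * partial_deriv b g x + partial_deriv b f x * g x)"
    if "b \<in> Basis" for b
  proof (intro ext partial_deriv_eqI)
    fix x
    have "((\<lambda>t. f (x + t *\<^sub>R b) * g (x + t *\<^sub>R b)) has_vector_derivative
        f (x + 0 *\<^sub>R b) * partial_deriv b g x + partial_deriv b f x * g (x + 0 *\<^sub>R b)) (at 0)"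
      using Suc.prems that
      by (intro has_vector_derivative_mult has_partial_deriv) (auto simp: C_class_Suc)
    then show "((\<lambda>t. f (x + t *\<^sub>R b) * g (x + t *\<^sub>R b)) has_vector_derivative
        f x * partial_deriv b g x + partial_deriv b f x * g x) (at 0)" by simp
  qed
  moreover have "C_class (enat n) f" "C_class (enat n) g"
    using Suc.prems by (auto intro: C_class_mono)
  ultimately show ?case using Suc
    by (auto simp: C_class_Suc intro!: continuous_intros C_class_add)
qed (auto simp: C_class_0 intro!: continuous_intros)

text \<open>The derivative \<open>- f' (1/f)\<^sup>2\<close> is a product of functions that are smooth to the lower order by
  hypothesis and by induction.\<close>

lemma C_class_inverse:
  assumes "C_class (enat n) f" "\<And>x. f x \<noteq> 0"
  shows "C_class (enat n) (\<lambda>x. inverse (f x))"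
  using assms(1)
proof (induction n)
  case (Suc n)
  have der: "((\<lambda>t. inverse (f (x + t *\<^sub>R b))) has_vector_derivative
       (-1) * (partial_deriv b f x * (inverse (f x) * inverse (f x)))) (at 0)"
    if "b \<in> Basis" for b x
  proof -
    have "((\<lambda>t. f (x + t *\<^sub>R b)) has_vector_derivative partial_deriv b f x) (at 0)"
      using Suc.prems that by (intro has_partial_deriv) (auto simp: C_class_Suc)
    moreover have "(inverse has_field_derivative - (inverse (f x) ^ Suc (Suc 0))) (at (f (x + 0 *\<^sub>R b)))"
      using DERIV_inverse[OF assms(2)[of x]] by simp
    ultimately have "(inverse \<circ> (\<lambda>t. f (x + t *\<^sub>R b)) has_vector_derivative
        partial_deriv b f x * - (inverse (f x) ^ Suc (Suc 0))) (at 0)"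
      by (rule field_vector_diff_chain_at)
    then show ?thesis by (simp add: o_def)
  qed
  then have "partial_deriv b (\<lambda>x. inverse (f x)) =
      (\<lambda>x. (-1) * (partial_deriv b f x * (inverse (f x) * inverse (f x))))" if "b \<in> Basis" for b
    using that by (intro ext partial_deriv_eqI) auto
  moreover have "C_class (enat n) (\<lambda>x. inverse (f x))"
    using Suc C_class_mono[of "enat (Suc n)" f "enat n"] by simp
  moreover have "(\<lambda>t. inverse (f (x + t *\<^sub>R b))) differentiable (at 0)" if "b \<in> Basis" for b x
    using der[OF that] by (auto simp: has_vector_derivative_def differentiable_def)
  moreover have "C_class (enat n) (\<lambda>x. (-1) * (partial_deriv b f x * (inverse (f x) * inverse (f x))))"
    if "b \<in> Basis" for b
    using Suc.prems that calculation(2)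
    by (intro C_class_mult C_class_const) (auto simp: C_class_Suc)
  ultimately show ?case using Suc.prems
    by (auto simp: C_class_Suc assms(2) intro!: continuous_intros)
qed (auto simp: C_class_0 assms(2) intro!: continuous_intros)

text \<open>A derivative of \<open>c (x\<^sub>i)\<close> in a fixed direction is a constant times \<open>c' (x\<^sub>i)\<close>, which is again a
  function of the coordinate; so the induction closes.\<close>

lemma C_class_coordinate:
  fixes c :: "real \<Rightarrow> complex"
  assumes "C_class (enat n) c"
  shows "C_class (enat n) (\<lambda>x :: real ^ 'n. c (x $ i))"
  using assms
proof (induction n arbitrary: c)
  case 0
  then show ?case
    by (auto simp: C_class_0 intro!: continuous_on_compose2[of UNIV c] continuous_intros)
next
  case (Suc n)
  have der: "((\<lambda>t. c ((x + t *\<^sub>R b) $ i)) has_vector_derivative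
      of_real (b $ i) * partial_deriv 1 c (x $ i)) (at 0)" for b x :: "real ^ 'n"
  proof -
    have "((\<lambda>t. x $ i + t * b $ i) has_vector_derivative b $ i) (at 0)"
      by (auto intro!: derivative_eq_intros simp: has_real_derivative_iff_has_vector_derivative[symmetric])
    moreover have "(c has_vector_derivative partial_deriv 1 c (x $ i)) (at (x $ i + 0 * b $ i))"
      using has_vector_derivative_along_line[of c 1 0 "x $ i"] Suc.prems
      by (auto simp: C_class_Suc)
    ultimately have "(c \<circ> (\<lambda>t. x $ i + t * b $ i) has_vector_derivative
        b $ i *\<^sub>R partial_deriv 1 c (x $ i)) (at 0)"
      by (rule vector_diff_chain_at)
    then show ?thesis by (simp add: o_def scaleR_conv_of_real[where 'a=complex])
  qed
  then have "partial_deriv b (\<lambda>x. c (x $ i)) = (\<lambda>x. of_real (b $ i) * partial_deriv 1 c (x $ i))"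
    for b :: "real ^ 'n"
    by (intro ext partial_deriv_eqI) auto
  moreover have "(\<lambda>t. c ((x + t *\<^sub>R b) $ i)) differentiable (at 0)" for b x :: "real ^ 'n"
    using der by (auto simp: has_vector_derivative_def differentiable_def)
  moreover have "continuous_on UNIV (\<lambda>x :: real ^ 'n. c (x $ i))"
    using Suc.prems
    by (auto simp: C_class_Suc intro!: continuous_on_compose2[of UNIV c] continuous_intros)
  moreover have "C_class (enat n) (\<lambda>x :: real ^ 'n. partial_deriv 1 c (x $ i))"
    using Suc by (auto simp: C_class_Suc)
  ultimately show ?case unfolding C_class_Suc
    by (auto intro!: C_class_mult C_class_const)
qed

lemma iter_partial_add_mult:
  assumes "C_class p f" "C_class p g" "w \<in> lists Basis" "enat (length w) \<le> p"
  shows "iter_partial w (\<lambda>x. f x + c * g x) = (\<lambda>x. iter_partial w f x + c * iter_partial w g x)"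
  using assms(3,4)
proof (induction w)
  case (Cons b w)
  then have "enat (length w) \<le> p"
    by (metis Suc_ile_eq length_Cons less_imp_le)
  with Cons have IH: "iter_partial w (\<lambda>x. f x + c * g x) = (\<lambda>x. iter_partial w f x + c * iter_partial w g x)"
    by simp
  have "w \<in> lists Basis" "b \<in> Basis" "enat (Suc (length w)) \<le> p"
    using Cons.hyps Cons.prems by simp_all
  then show ?case
    unfolding iter_partial_Cons IH
    using assms(1,2)
    by (intro ext partial_deriv_eqI has_vector_derivative_add has_vector_derivative_mult_right
        has_partial_deriv C_class_differentiable)
qed simp

section \<open>Jets, and the topology of \<open>C\<^sup>p(\<gamma>)\<close>\<close>

text \<open>In angular coordinates a function on \<open>K\<close> becomes a periodic function on a vector space, which
  determines it.\<close>

definition pullback ::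
    "('n::finite \<Rightarrow> complex \<Rightarrow> complex) \<Rightarrow> (complex ^ 'n \<Rightarrow> complex) \<Rightarrow> real ^ 'n \<Rightarrow> complex" where
  "pullback \<gamma> f = (\<lambda>\<theta>. f (prod_curve \<gamma> (torus_exp \<theta>)))"

definition words :: "enat \<Rightarrow> 'a::euclidean_space list set" where
  "words p = {w \<in> lists Basis. enat (length w) \<le> p}"

text \<open>The jet is meaningful for \<open>f\<close> of class \<open>C\<^sup>p\<close> and \<open>w\<close> of length at most \<open>p\<close>; then the derivative is
  continuous, and bounded by periodicity, so that it lies in the Banach space of bounded continuous
  functions.\<close>

definition jet ::
    "('n::finite \<Rightarrow> complex \<Rightarrow> complex) \<Rightarrow> (complex ^ 'n \<Rightarrow> complex) \<Rightarrow>
      (real ^ 'n) list \<Rightarrow> (real ^ 'n) \<Rightarrow>\<^sub>C complex" where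
  "jet \<gamma> f w = Bcontfun (iter_partial w (pullback \<gamma> f))"

lemma words_Nil [simp]: "[] \<in> words p"
  by (simp add: words_def zero_enat_def[symmetric])

lemma words_Cons: "b # w \<in> words p \<longleftrightarrow> b \<in> Basis \<and> w \<in> lists Basis \<and> enat (Suc (length w)) \<le> p"
  by (auto simp: words_def)

lemma words_ConsD: "b # w \<in> words p \<Longrightarrow> w \<in> words p"
  by (auto simp: words_def Suc_ile_eq intro: less_imp_le)

lemma countable_words: "countable (words p :: 'a::euclidean_space list set)"
proof -
  have "countable (lists (Basis :: 'a set))"
    by (intro countable_lists countable_finite finite_Basis)
  then show ?thesis by (rule countable_subset[rotated]) (auto simp: words_def)
qed

lemma torus_exp_in_torus: "torus_exp \<theta> \<in> torus"
  by (simp add: torus_exp_def torus_def)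

lemma range_torus_exp: "range torus_exp = (torus :: (complex ^ 'n) set)"
proof
  show "(torus :: (complex ^ 'n) set) \<subseteq> range torus_exp"
  proof
    fix z :: "complex ^ 'n" assume z: "z \<in> torus"
    have "cis (Arg (z $ i)) = z $ i" for i
    proof -
      have "norm (z $ i) = 1" using z by (simp add: torus_def)
      then have "z $ i \<noteq> 0" by force
      with cis_Arg[OF this] \<open>norm (z $ i) = 1\<close> show ?thesis by (simp add: sgn_eq)
    qed
    then have "z = torus_exp (\<chi> i. Arg (z $ i))"
      by (simp add: torus_exp_def vec_eq_iff)
    then show "z \<in> range torus_exp" by blast
  qed
qed (auto simp: torus_exp_in_torus)

lemma curve_image_eq: "curve_image \<gamma> = range (\<lambda>\<theta>. prod_curve \<gamma> (torus_exp \<theta>))"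
  unfolding curve_image_def range_torus_exp[symmetric] by auto

lemma in_C_space_iff:
  "f \<in> C_space p \<gamma> \<longleftrightarrow> f \<in> extensional (curve_image \<gamma>) \<and> C_class p (pullback \<gamma> f)"
  by (simp add: C_space_def C_torus_def pullback_def)

lemma pullback_restrict [simp]: "pullback \<gamma> (restrict f (curve_image \<gamma>)) = pullback \<gamma> f"
  by (auto simp: pullback_def curve_image_eq)

text \<open>Derivatives inherit the periods of a function; for the pullback these are the multiples of \<open>2\<pi>\<close>.\<close>

lemma iter_partial_translation_invariant:
  assumes "\<And>\<theta>. h (\<theta> + \<tau>) = h \<theta>"
  shows "iter_partial w h (\<theta> + \<tau>) = iter_partial w h \<theta>"
proof (induction w arbitrary: \<theta>)
  case (Cons b w)
  have "iter_partial w h (\<theta> + \<tau> + t *\<^sub>R b) = iter_partial w h (\<theta> + t *\<^sub>R b)" for t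
    using Cons[of "\<theta> + t *\<^sub>R b"] by (simp add: algebra_simps)
  then show ?case by (simp add: iter_partial_Cons partial_deriv_def)
qed (simp add: assms)

text \<open>By periodicity all values are attained on a compact cube.\<close>

lemma bounded_range_iter_partial_pullback:
  assumes "continuous_on UNIV (iter_partial w (pullback \<gamma> f))"
  shows "bounded (range (iter_partial w (pullback \<gamma> f)))"
proof -
  let ?h = "iter_partial w (pullback \<gamma> f)"
  let ?Q = "cbox 0 (\<chi> i. 2 * pi) :: (real ^ 'a) set"
  have "?h \<theta> \<in> ?h ` ?Q" for \<theta>
  proof -
    \<comment> \<open>The period that brings each angle into \<open>[0, 2\<pi>)\<close>.\<close>
    define \<tau> :: "real ^ 'a" where "\<tau> = (\<chi> i. - (2 * pi * of_int \<lfloor>\<theta> $ i / (2 * pi)\<rfloor>))"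
    have "cis (x + \<tau> $ i) = cis x" for x i
      by (simp add: \<tau>_def cis_mult[symmetric] cis_multiple_2pi flip: diff_conv_add_uminus cis_divide)
    then have "torus_exp (x + \<tau>) = torus_exp x" for x
      by (simp add: torus_exp_def)
    then have "?h (\<theta> + \<tau>) = ?h \<theta>"
      by (intro iter_partial_translation_invariant) (simp add: pullback_def)
    moreover have "0 \<le> \<theta> $ i + \<tau> $ i \<and> \<theta> $ i + \<tau> $ i \<le> 2 * pi" for i
    proof -
      define k where "k = \<theta> $ i / (2 * pi)"
      have "\<theta> $ i = 2 * pi * k" "\<theta> $ i + \<tau> $ i = 2 * pi * (k - of_int \<lfloor>k\<rfloor>)"
        by (simp_all add: \<tau>_def k_def field_simps)
      moreover have "0 \<le> k - of_int \<lfloor>k\<rfloor>" "k - of_int \<lfloor>k\<rfloor> \<le> 1" by linarith+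
      ultimately show ?thesis by (simp add: mult_left_le)
    qed
    then have "\<theta> + \<tau> \<in> ?Q" by (simp add: mem_box_cart)
    ultimately show ?thesis by (metis image_eqI)
  qed
  then have "range ?h \<subseteq> ?h ` ?Q" by blast
  moreover have "compact (?h ` ?Q)"
    by (intro compact_continuous_image continuous_on_subset[OF assms]) auto
  ultimately show ?thesis by (meson bounded_subset compact_imp_bounded)
qed

lemma apply_jet:
  assumes "f \<in> C_space p \<gamma>" "w \<in> words p"
  shows "apply_bcontfun (jet \<gamma> f w) = iter_partial w (pullback \<gamma> f)"
proof -
  have "continuous_on UNIV (iter_partial w (pullback \<gamma> f))"
    using assms by (simp add: in_C_space_iff C_class_def words_def)
  then show ?thesis
    unfolding jet_def
    by (intro Bcontfun_inverse) (simp add: bcontfun_def bounded_range_iter_partial_pullback)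
qed

lemma jet_Nil_apply:
  assumes "f \<in> C_space p \<gamma>"
  shows "apply_bcontfun (jet \<gamma> f []) \<theta> = f (prod_curve \<gamma> (torus_exp \<theta>))"
  using apply_jet[OF assms words_Nil] by (simp add: pullback_def)

lemma C_space_eqI:
  assumes "f \<in> C_space p \<gamma>" "g \<in> C_space p \<gamma>" "jet \<gamma> f [] = jet \<gamma> g []"
  shows "f = g"
proof (rule extensionalityI)
  show "f \<in> extensional (curve_image \<gamma>)" "g \<in> extensional (curve_image \<gamma>)"
    using assms by (auto simp: in_C_space_iff)
  show "f z = g z" if "z \<in> curve_image \<gamma>" for z
    using that assms jet_Nil_apply[OF assms(1)] jet_Nil_apply[OF assms(2)]
    by (auto simp: curve_image_eq)
qed

text \<open>This identity allows the seminorms to be forgotten: from here on the topology is described by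
  distances in the space of bounded continuous functions.\<close>

lemma C_seminorm_diff_eq_dist:
  assumes "f \<in> C_space p \<gamma>" "g \<in> C_space p \<gamma>" "w \<in> words p"
  shows "C_seminorm \<gamma> w (\<lambda>z. g z - f z) = dist (jet \<gamma> g w) (jet \<gamma> f w)"
proof -
  have "iter_partial w (\<lambda>\<theta>. pullback \<gamma> g \<theta> + (-1) * pullback \<gamma> f \<theta>) =
      (\<lambda>\<theta>. iter_partial w (pullback \<gamma> g) \<theta> + (-1) * iter_partial w (pullback \<gamma> f) \<theta>)"
    using assms by (intro iter_partial_add_mult[of p]) (auto simp: in_C_space_iff words_def)
  moreover have "(\<lambda>\<theta>. pullback \<gamma> g \<theta> + (-1) * pullback \<gamma> f \<theta>) =
      (\<lambda>\<theta>. g (prod_curve \<gamma> (torus_exp \<theta>)) - f (prod_curve \<gamma> (torus_exp \<theta>)))"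
    by (simp add: pullback_def)
  ultimately show ?thesis
    by (simp add: C_seminorm_def dist_bcontfun_def apply_jet[OF assms(1,3)] apply_jet[OF assms(2,3)] dist_norm)
qed

lemma C_topology_eq_jet_balls:
  "C_topology p \<gamma> = topology_generated_by
     {{g \<in> C_space p \<gamma>. dist (jet \<gamma> g w) (jet \<gamma> f w) < \<epsilon>} | f w \<epsilon>.
        f \<in> C_space p \<gamma> \<and> w \<in> words p \<and> 0 < \<epsilon>}"
proof -
  have "{g \<in> C_space p \<gamma>. C_seminorm \<gamma> w (\<lambda>z. g z - f z) < \<epsilon>} =
      {g \<in> C_space p \<gamma>. dist (jet \<gamma> g w) (jet \<gamma> f w) < \<epsilon>}"
    if "f \<in> C_space p \<gamma>" "w \<in> words p" for f w \<epsilon>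
    using C_seminorm_diff_eq_dist[OF that(1) _ that(2)] by auto
  then have "{{g \<in> C_space p \<gamma>. C_seminorm \<gamma> w (\<lambda>z. g z - f z) < \<epsilon>} | f w \<epsilon>.
        f \<in> C_space p \<gamma> \<and> w \<in> words p \<and> 0 < \<epsilon>} =
      {{g \<in> C_space p \<gamma>. dist (jet \<gamma> g w) (jet \<gamma> f w) < \<epsilon>} | f w \<epsilon>.
        f \<in> C_space p \<gamma> \<and> w \<in> words p \<and> 0 < \<epsilon>}"
    by (intro Collect_cong iff_exI) (metis (no_types, lifting))
  then show ?thesis
    by (simp add: C_topology_def words_def)
qed

lemma openin_jet_ball:
  assumes "f \<in> C_space p \<gamma>" "w \<in> words p" "0 < \<epsilon>"
  shows "openin (C_topology p \<gamma>) {g \<in> C_space p \<gamma>. dist (jet \<gamma> g w) (jet \<gamma> f w) < \<epsilon>}"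
  unfolding C_topology_eq_jet_balls using assms
  by (intro topology_generated_by_Basis) blast

lemma continuous_map_jet:
  assumes "w \<in> words p"
  shows "continuous_map (C_topology p \<gamma>) euclidean (\<lambda>f. jet \<gamma> f w)"
  unfolding continuous_map_def topspace_C_topology
proof (intro conjI allI impI)
  fix U :: "((real ^ 'a) \<Rightarrow>\<^sub>C complex) set" assume "openin euclidean U"
  then have U: "open U" by simp
  show "openin (C_topology p \<gamma>) {f \<in> C_space p \<gamma>. jet \<gamma> f w \<in> U}"
  proof (subst openin_subopen, intro ballI)
    fix f assume f: "f \<in> {f \<in> C_space p \<gamma>. jet \<gamma> f w \<in> U}"
    then obtain e where e: "e > 0" "\<And>y. dist y (jet \<gamma> f w) < e \<Longrightarrow> y \<in> U"
      using U unfolding open_dist by blast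
    then show "\<exists>T. openin (C_topology p \<gamma>) T \<and> f \<in> T \<and> T \<subseteq> {f \<in> C_space p \<gamma>. jet \<gamma> f w \<in> U}"
      using f openin_jet_ball[OF _ assms, of f \<gamma> e]
      by (intro exI[of _ "{g \<in> C_space p \<gamma>. dist (jet \<gamma> g w) (jet \<gamma> f w) < e}"]) auto
  qed
qed auto

text \<open>The source of completeness: along each line in direction \<open>b\<close> this is the theorem on differentiating
  a limit term by term when the derivatives converge uniformly.\<close>

lemma closed_derivative_graph:
  "closed {(g :: 'a::euclidean_space \<Rightarrow>\<^sub>C complex, g' :: 'a \<Rightarrow>\<^sub>C complex).
     \<forall>x. ((\<lambda>t. g (x + t *\<^sub>R b)) has_vector_derivative g' x) (at 0)}" (is "closed ?G")
  unfolding closed_sequential_limits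
proof (intro allI impI, elim conjE)
  fix q :: "nat \<Rightarrow> ('a \<Rightarrow>\<^sub>C complex) \<times> ('a \<Rightarrow>\<^sub>C complex)" and l
  assume q: "\<forall>n. q n \<in> ?G" and lim: "q \<longlonglongrightarrow> l"
  obtain l1 l2 where l: "l = (l1, l2)" by fastforce
  have lim1: "(\<lambda>n. fst (q n)) \<longlonglongrightarrow> l1" and lim2: "(\<lambda>n. snd (q n)) \<longlonglongrightarrow> l2"
    using tendsto_fst[OF lim] tendsto_snd[OF lim] l by auto
  have "((\<lambda>t. l1 (x + t *\<^sub>R b)) has_vector_derivative l2 x) (at 0)" for x
  proof -
    have der: "((\<lambda>t. fst (q n) (x + t *\<^sub>R b)) has_vector_derivative snd (q n) (x + t *\<^sub>R b)) (at t)"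
      for n t
    proof -
      have D: "((\<lambda>t. fst (q n) (x + t *\<^sub>R b)) has_vector_derivative snd (q n) x) (at 0)" for x
        using q by (auto simp: case_prod_unfold)
      then have "partial_deriv b (fst (q n)) = snd (q n)"
        by (intro ext partial_deriv_eqI)
      then show ?thesis
        using has_vector_derivative_along_line[of "fst (q n)" b x t] D
        by (auto simp: has_vector_derivative_def differentiable_def)
    qed
    have "\<exists>g. \<forall>t\<in>UNIV. (\<lambda>n. fst (q n) (x + t *\<^sub>R b)) \<longlonglongrightarrow> g t \<and>
        (g has_derivative (\<lambda>h. h *\<^sub>R l2 (x + t *\<^sub>R b))) (at t within UNIV)"
    proof (rule has_derivative_sequence)
      show "((\<lambda>t. fst (q n) (x + t *\<^sub>R b)) has_derivative (\<lambda>h. h *\<^sub>R snd (q n) (x + t *\<^sub>R b))) (at t within UNIV)"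
        for n t using der[of n t] by (simp add: has_vector_derivative_def)
      show "(\<lambda>n. fst (q n) (x + 0 *\<^sub>R b)) \<longlonglongrightarrow> l1 x"
        using tendsto_uniform_limitI[OF tendsto_bcontfun_uniform_limit[OF lim1], of x] by simp
      fix e :: real assume "0 < e"
      from uniform_limitD[OF tendsto_bcontfun_uniform_limit[OF lim2] this]
      show "\<forall>\<^sub>F n in sequentially. \<forall>t\<in>UNIV. \<forall>h.
          norm (h *\<^sub>R snd (q n) (x + t *\<^sub>R b) - h *\<^sub>R l2 (x + t *\<^sub>R b)) \<le> e * norm h"
      proof eventually_elim
        case (elim n)
        show ?case
        proof (intro ballI allI)
          fix t h :: real
          have "norm (snd (q n) (x + t *\<^sub>R b) - l2 (x + t *\<^sub>R b)) \<le> e"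
            using elim by (simp add: dist_norm less_imp_le)
          then show "norm (h *\<^sub>R snd (q n) (x + t *\<^sub>R b) - h *\<^sub>R l2 (x + t *\<^sub>R b)) \<le> e * norm h"
            by (simp add: scaleR_diff_right[symmetric]) (metis abs_ge_zero mult.commute mult_right_mono)
        qed
      qed
    qed auto
    then obtain g where g: "\<And>t. (\<lambda>n. fst (q n) (x + t *\<^sub>R b)) \<longlonglongrightarrow> g t"
        "\<And>t. (g has_derivative (\<lambda>h. h *\<^sub>R l2 (x + t *\<^sub>R b))) (at t)" by auto
    have "g = (\<lambda>t. l1 (x + t *\<^sub>R b))"
      using g(1) tendsto_uniform_limitI[OF tendsto_bcontfun_uniform_limit[OF lim1]]
      by (intro ext) (blast intro: LIMSEQ_unique)
    with g(2)[of 0] show ?thesis by (simp add: has_vector_derivative_def)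
  qed
  then show "l \<in> ?G" using l by auto
qed

text \<open>All jets collected into one point of a product; cutting down to \<open>words p\<close> makes it an element of the
  extensional product.\<close>

definition jets ::
    "enat \<Rightarrow> ('n::finite \<Rightarrow> complex \<Rightarrow> complex) \<Rightarrow> (complex ^ 'n \<Rightarrow> complex) \<Rightarrow>
      (real ^ 'n) list \<Rightarrow> (real ^ 'n) \<Rightarrow>\<^sub>C complex" where
  "jets p \<gamma> f = restrict (jet \<gamma> f) (words p)"

abbreviation jet_space :: "enat \<Rightarrow> ((real ^ 'n::finite) list \<Rightarrow> (real ^ 'n) \<Rightarrow>\<^sub>C complex) topology" where
  "jet_space p \<equiv> product_topology (\<lambda>_. euclidean) (words p)"

text \<open>A family of bounded continuous functions is the family of jets of some \<open>f\<close> as soon as its member at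
  the empty word factors through the curve and consecutive members are derivatives of each other.
  Both conditions are closed; that is why this description is wanted.\<close>

lemma jets_image_eq:
  fixes \<gamma> :: "'n::finite \<Rightarrow> complex \<Rightarrow> complex"
  shows "jets p \<gamma> ` C_space p \<gamma> = {G :: (real ^ 'n) list \<Rightarrow> (real ^ 'n) \<Rightarrow>\<^sub>C complex.
     G \<in> topspace (jet_space p) \<and>
     (\<forall>\<theta> \<theta>'. prod_curve \<gamma> (torus_exp \<theta>) = prod_curve \<gamma> (torus_exp \<theta>') \<longrightarrow> G [] \<theta> = G [] \<theta>') \<and>
     (\<forall>b w. b # w \<in> words p \<longrightarrow>
        (\<forall>x. ((\<lambda>t. G w (x + t *\<^sub>R b)) has_vector_derivative G (b # w) x) (at 0)))}"
  (is "_ = ?R")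
proof (intro equalityI subsetI)
  fix G assume "G \<in> jets p \<gamma> ` C_space p \<gamma>"
  then obtain f where f: "f \<in> C_space p \<gamma>" and G: "G = jets p \<gamma> f" by blast
  have GA: "apply_bcontfun (G w) = iter_partial w (pullback \<gamma> f)" if "w \<in> words p" for w
    using that f by (simp add: G jets_def apply_jet)
  have "((\<lambda>t. G w (x + t *\<^sub>R b)) has_vector_derivative G (b # w) x) (at 0)"
    if bw: "b # w \<in> words p" for b w x
    unfolding GA[OF bw] GA[OF words_ConsD[OF bw]] iter_partial_Cons
    using f bw by (intro has_partial_deriv C_class_differentiable) (auto simp: in_C_space_iff words_Cons)
  then show "G \<in> ?R"
    by (auto simp: GA words_Nil pullback_def) (simp add: G jets_def)
next
  fix G assume G: "G \<in> ?R"
  \<comment> \<open>The choice of preimage is immaterial, as \<open>G []\<close> is constant on the fibres of the curve.\<close>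
  define sel where "sel z = (SOME \<theta>. prod_curve \<gamma> (torus_exp \<theta>) = z)" for z
  define f where "f = restrict (\<lambda>z. G [] (sel z)) (curve_image \<gamma>)"
  have top: "G \<in> topspace (jet_space p)"
    and fib: "\<And>\<theta> \<theta>'. prod_curve \<gamma> (torus_exp \<theta>) = prod_curve \<gamma> (torus_exp \<theta>') \<Longrightarrow> G [] \<theta> = G [] \<theta>'"
    and der: "\<And>b w x. b # w \<in> words p \<Longrightarrow>
      ((\<lambda>t. G w (x + t *\<^sub>R b)) has_vector_derivative G (b # w) x) (at 0)"
    using G unfolding mem_Collect_eq by (elim conjE; iprover)+
  have sel: "prod_curve \<gamma> (torus_exp (sel (prod_curve \<gamma> (torus_exp \<theta>)))) = prod_curve \<gamma> (torus_exp \<theta>)"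
    for \<theta> unfolding sel_def by (rule someI) (rule refl)
  have pb: "pullback \<gamma> f = G []"
    unfolding f_def pullback_restrict unfolding pullback_def by (intro ext fib sel)
  have it: "iter_partial w (pullback \<gamma> f) = G w" if "w \<in> words p" for w
    using that
  proof (induction w rule: list.induct)
    case (Cons b w)
    then have "iter_partial w (pullback \<gamma> f) = G w" by (blast dest: words_ConsD)
    then show ?case
      using der[OF Cons.prems] by (auto simp: iter_partial_Cons intro!: partial_deriv_eqI)
  qed (simp add: pb)
  have "C_class p (pullback \<gamma> f)"
    unfolding C_class_def
  proof (intro conjI ballI impI allI)
    fix w x and b :: "real ^ 'n"
    assume "w \<in> lists Basis" "b \<in> Basis" "enat (length (b # w)) \<le> p"
    then have bw: "b # w \<in> words p" by (simp add: words_def)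
    show "(\<lambda>t. iter_partial w (pullback \<gamma> f) (x + t *\<^sub>R b)) differentiable (at 0)"
      using der[OF bw, of x] it[OF words_ConsD[OF bw]]
      by (auto simp: has_vector_derivative_def differentiable_def)
  qed (simp add: it words_def)
  then have f: "f \<in> C_space p \<gamma>"
    by (simp add: in_C_space_iff f_def)
  moreover have "G = jets p \<gamma> f"
  proof
    fix w show "G w = jets p \<gamma> f w"
      using apply_jet[OF f, of w] it[of w] top
      by (cases "w \<in> words p") (auto simp: jets_def apply_bcontfun_inject PiE_def extensional_def)
  qed
  ultimately show "G \<in> jets p \<gamma> ` C_space p \<gamma>" by blast
qed

lemma closedin_jets_image: "closedin (jet_space p) (jets p \<gamma> ` C_space p \<gamma>)"
proof -
  let ?P = "jet_space p :: ((real ^ 'a) list \<Rightarrow> (real ^ 'a) \<Rightarrow>\<^sub>C complex) topology"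
  define D where "D b = {(g :: (real ^ 'a) \<Rightarrow>\<^sub>C complex, g' :: (real ^ 'a) \<Rightarrow>\<^sub>C complex).
     \<forall>x. ((\<lambda>t. g (x + t *\<^sub>R b)) has_vector_derivative g' x) (at 0)}" for b
  define A where "A \<theta> \<theta>' = {G \<in> topspace ?P. G [] \<in> {g :: (real ^ 'a) \<Rightarrow>\<^sub>C complex. g \<theta> = g \<theta>'}}" for \<theta> \<theta>'
  define B where "B b w = {G \<in> topspace ?P. (G w, G (b # w)) \<in> D b}" for b w
  have proj: "continuous_map ?P euclidean (\<lambda>G. G w)" if "w \<in> words p" for w
    using continuous_map_product_projection[OF that] .
  have eval: "continuous_on UNIV (\<lambda>g :: (real ^ 'a) \<Rightarrow>\<^sub>C complex. g \<theta>)" for \<theta>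
    unfolding continuous_on_sequentially
    using tendsto_uniform_limitI[OF tendsto_bcontfun_uniform_limit] by (fastforce simp: o_def)
  have A: "closedin ?P (A \<theta> \<theta>')" for \<theta> \<theta>'
    unfolding A_def
    by (intro closedin_continuous_map_preimage[OF proj[OF words_Nil]])
      (simp add: closed_Collect_eq eval)
  have B: "closedin ?P (B b w)" if bw: "b # w \<in> words p" for b w
  proof -
    have "continuous_map ?P euclidean (\<lambda>G. (G w, G (b # w)))"
      using continuous_map_pairedI[OF proj[OF words_ConsD[OF bw]] proj[OF bw]]
      by simp
    then show ?thesis
      unfolding B_def using closed_derivative_graph[of b]
      by (intro closedin_continuous_map_preimage) (auto simp: D_def)
  qed
  let ?F = "insert (topspace ?P)
     ({A \<theta> \<theta>' | \<theta> \<theta>'. prod_curve \<gamma> (torus_exp \<theta>) = prod_curve \<gamma> (torus_exp \<theta>')} \<union>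
      {B b w | b w. b # w \<in> words p})"
  have A_iff: "G \<in> A \<theta> \<theta>' \<longleftrightarrow> G \<in> topspace ?P \<and> G [] \<theta> = G [] \<theta>'" for G \<theta> \<theta>'
    unfolding A_def by (simp only: mem_Collect_eq)
  have B_iff: "G \<in> B b w \<longleftrightarrow> G \<in> topspace ?P \<and>
      (\<forall>x. ((\<lambda>t. G w (x + t *\<^sub>R b)) has_vector_derivative G (b # w) x) (at 0))" for G b w
    unfolding B_def D_def by (simp only: mem_Collect_eq case_prod_conv)
  have "jets p \<gamma> ` C_space p \<gamma> = \<Inter> ?F"
  proof (intro equalityI subsetI)
    fix G assume "G \<in> jets p \<gamma> ` C_space p \<gamma>"
    then have G: "G \<in> topspace ?P \<and>
       (\<forall>\<theta> \<theta>'. prod_curve \<gamma> (torus_exp \<theta>) = prod_curve \<gamma> (torus_exp \<theta>') \<longrightarrow> G [] \<theta> = G [] \<theta>') \<and>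
       (\<forall>b w. b # w \<in> words p \<longrightarrow>
          (\<forall>x. ((\<lambda>t. G w (x + t *\<^sub>R b)) has_vector_derivative G (b # w) x) (at 0)))"
      unfolding jets_image_eq mem_Collect_eq .
    show "G \<in> \<Inter> ?F"
    proof (rule InterI)
      fix S assume "S \<in> ?F"
      then consider "S = topspace ?P"
        | \<theta> \<theta>' where "S = A \<theta> \<theta>'" "prod_curve \<gamma> (torus_exp \<theta>) = prod_curve \<gamma> (torus_exp \<theta>')"
        | b w where "S = B b w" "b # w \<in> words p" by blast
      then show "G \<in> S"
      proof cases
        case 1
        then show ?thesis using G by (simp only:)
      next
        case 2
        then show ?thesis using G A_iff by metis
      next
        case 3
        then show ?thesis using G B_iff by metis
      qed
    qed
  next
    fix G assume "G \<in> \<Inter> ?F"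
    then have G: "\<And>S. S \<in> ?F \<Longrightarrow> G \<in> S" by (rule InterD)
    show "G \<in> jets p \<gamma> ` C_space p \<gamma>"
      unfolding jets_image_eq mem_Collect_eq
    proof (intro conjI allI impI)
      show "G \<in> topspace ?P" by (rule G[OF insertI1])
      show "G [] \<theta> = G [] \<theta>'" if "prod_curve \<gamma> (torus_exp \<theta>) = prod_curve \<gamma> (torus_exp \<theta>')" for \<theta> \<theta>'
      proof -
        have "G \<in> A \<theta> \<theta>'" by (rule G) (use that in blast)
        then show ?thesis using A_iff by metis
      qed
      show "((\<lambda>t. G w (x + t *\<^sub>R b)) has_vector_derivative G (b # w) x) (at 0)" if "b # w \<in> words p" for b w x
      proof -
        have "G \<in> B b w" by (rule G) (use that in blast)
        then show ?thesis using B_iff by metis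
      qed
    qed
  qed
  moreover have "closedin ?P (\<Inter> ?F)"
    using A B closedin_topspace[of ?P] by (intro closedin_Inter) auto
  ultimately show ?thesis by simp
qed

text \<open>The generating sets of the topology are preimages of balls under the coordinates of the product, so
  the jet map is continuous in both directions.\<close>

lemma homeomorphic_jets:
  "C_topology p \<gamma> homeomorphic_space subtopology (jet_space p) (jets p \<gamma> ` C_space p \<gamma>)"
proof -
  let ?C = "C_space p \<gamma>"
  let ?Y = "subtopology (jet_space p) (jets p \<gamma> ` ?C)"
  let ?inv = "inv_into ?C (jets p \<gamma>)"
  have inj: "inj_on (jets p \<gamma>) ?C"
  proof (rule inj_onI)
    fix f g assume fg: "f \<in> ?C" "g \<in> ?C" and "jets p \<gamma> f = jets p \<gamma> g"
    then have "jets p \<gamma> f [] = jets p \<gamma> g []" by simp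
    then show "f = g" using C_space_eqI[OF fg] by (simp add: jets_def)
  qed
  have topY: "topspace ?Y = jets p \<gamma> ` ?C"
    using closedin_subset[OF closedin_jets_image, of p \<gamma>] by auto
  have "continuous_map (C_topology p \<gamma>) (jet_space p) (jets p \<gamma>)"
  proof (rule continuous_map_coordinatewise_then_product)
    show "continuous_map (C_topology p \<gamma>) euclidean (\<lambda>f. jets p \<gamma> f w)" if "w \<in> words p" for w
      using continuous_map_jet[OF that] that by (simp add: jets_def)
  qed (simp add: jets_def)
  then have c1: "continuous_map (C_topology p \<gamma>) ?Y (jets p \<gamma>)"
    by (simp add: continuous_map_in_subtopology topspace_C_topology)
  have c2: "continuous_map ?Y (C_topology p \<gamma>) ?inv"
    unfolding C_topology_eq_jet_balls
  proof (rule continuous_on_generated_topo)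
    show "?inv ` topspace ?Y \<subseteq> \<Union> {{g \<in> ?C. dist (jet \<gamma> g w) (jet \<gamma> f w) < \<epsilon>} | f w \<epsilon>.
        f \<in> ?C \<and> w \<in> words p \<and> 0 < \<epsilon>}"
      using topspace_C_topology[of p \<gamma>]
      unfolding C_topology_eq_jet_balls topology_generated_by_topspace topY
      by (auto simp: inv_into_f_f[OF inj])
    fix U assume "U \<in> {{g \<in> ?C. dist (jet \<gamma> g w) (jet \<gamma> f w) < \<epsilon>} | f w \<epsilon>.
        f \<in> ?C \<and> w \<in> words p \<and> 0 < \<epsilon>}"
    then obtain f w \<epsilon> where U: "U = {g \<in> ?C. dist (jet \<gamma> g w) (jet \<gamma> f w) < \<epsilon>}" and w: "w \<in> words p"
      by blast
    have "?inv -` U \<inter> topspace ?Y = {G \<in> topspace ?Y. G w \<in> ball (jet \<gamma> f w) \<epsilon>}"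
    proof -
      have "jets p \<gamma> g w = jet \<gamma> g w" for g using w by (simp add: jets_def)
      then show ?thesis
        unfolding topY U by (auto simp: inv_into_f_f[OF inj] dist_commute)
    qed
    moreover have "openin ?Y {G \<in> topspace ?Y. G w \<in> ball (jet \<gamma> f w) \<epsilon>}"
      by (rule openin_continuous_map_preimage[of _ euclidean])
        (auto intro!: continuous_map_from_subtopology continuous_map_product_projection w)
    ultimately show "openin ?Y (?inv -` U \<inter> topspace ?Y)" by simp
  qed
  have "homeomorphic_maps (C_topology p \<gamma>) ?Y (jets p \<gamma>) ?inv"
    unfolding homeomorphic_maps_def topY topspace_C_topology
    using c1 c2 by (auto simp: inv_into_f_f[OF inj])
  then show ?thesis by (rule homeomorphic_maps_imp_homeomorphic_space)
qed

theorem completely_metrizable_C_topology: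
  fixes \<gamma> :: "'n::finite \<Rightarrow> complex \<Rightarrow> complex"
  shows "completely_metrizable_space (C_topology p \<gamma>)"
proof -
  have "completely_metrizable_space (jet_space p :: ((real ^ 'n) list \<Rightarrow> (real ^ 'n) \<Rightarrow>\<^sub>C complex) topology)"
  proof (rule completely_metrizable_space_product_topology[THEN iffD2, OF disjI2], rule conjI)
    show "countable {w \<in> words p. \<nexists>a. topspace (euclidean :: ((real ^ 'n) \<Rightarrow>\<^sub>C complex) topology) \<subseteq> {a}}"
      by (rule countable_subset[OF Collect_restrict countable_words])
    show "\<forall>w\<in>words p. completely_metrizable_space (euclidean :: ((real ^ 'n) \<Rightarrow>\<^sub>C complex) topology)"
      by (intro ballI completely_metrizable_space_euclidean)
  qed
  then have "completely_metrizable_space (subtopology (jet_space p) (jets p \<gamma> ` C_space p \<gamma>))"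
    by (rule completely_metrizable_space_closedin[OF _ closedin_jets_image])
  then show ?thesis
    by (rule homeomorphic_completely_metrizable_space[OF homeomorphic_jets, THEN iffD2])
qed

section \<open>Bounded holomorphic functions of several variables\<close>

lemma norm_vector_scalar_mult: "norm (c *s v) = cmod c * norm v" for v :: "complex ^ 'n"
  by (simp add: norm_vec_def norm_mult L2_set_right_distrib)

lemma bounded_linear_vector_scalar_mult: "bounded_linear (\<lambda>c. c *s v)" for v :: "complex ^ 'n"
  by (rule bounded_linear_intro[where K="norm v"])
    (simp_all add: norm_vector_scalar_mult vec_eq_iff algebra_simps)

lemma holomorphic_cn_on_subset: "holomorphic_cn_on F U \<Longrightarrow> V \<subseteq> U \<Longrightarrow> holomorphic_cn_on F V"
  unfolding holomorphic_cn_on_def by blast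

lemma holomorphic_cn_on_diff:
  assumes "holomorphic_cn_on F U" "holomorphic_cn_on G U"
  shows "holomorphic_cn_on (\<lambda>z. F z - G z) U"
  unfolding holomorphic_cn_on_def
proof
  fix z assume "z \<in> U"
  then obtain D E where "(F has_derivative D) (at z)" "\<forall>c v. D (c *s v) = c * D v"
      "(G has_derivative E) (at z)" "\<forall>c v. E (c *s v) = c * E v"
    using assms unfolding holomorphic_cn_on_def by meson
  then show "\<exists>D. ((\<lambda>z. F z - G z) has_derivative D) (at z) \<and> (\<forall>c v. D (c *s v) = c * D v)"
    by (intro exI[of _ "\<lambda>v. D v - E v"]) (auto intro: has_derivative_diff simp: algebra_simps)
qed

lemma holomorphic_cn_on_frechet:
  assumes "holomorphic_cn_on F U" "z \<in> U"
  shows "(F has_derivative frechet_derivative F (at z)) (at z)"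
    and "frechet_derivative F (at z) (c *s v) = c * frechet_derivative F (at z) v"
proof -
  obtain D where "(F has_derivative D) (at z)" "\<forall>c v. D (c *s v) = c * D v"
    using assms unfolding holomorphic_cn_on_def by meson
  moreover from this have "D = frechet_derivative F (at z)"
    by (intro frechet_derivative_at)
  ultimately show "(F has_derivative frechet_derivative F (at z)) (at z)"
    and "frechet_derivative F (at z) (c *s v) = c * frechet_derivative F (at z) v" by auto
qed

lemma holomorphic_cn_on_continuous_on: "holomorphic_cn_on F U \<Longrightarrow> continuous_on U F"
  by (meson continuous_at_imp_continuous_on has_derivative_continuous holomorphic_cn_on_def)

text \<open>Restriction to a complex line makes the one-variable theory applicable.\<close>

lemma slice_has_field_derivative:
  assumes "holomorphic_cn_on F U" "u + \<zeta> *s v \<in> U"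
  shows "((\<lambda>\<zeta>. F (u + \<zeta> *s v)) has_field_derivative
      frechet_derivative F (at (u + \<zeta> *s v)) v) (at \<zeta>)"
proof -
  have "((\<lambda>\<zeta>. u + \<zeta> *s v) has_derivative (\<lambda>\<zeta>. \<zeta> *s v)) (at \<zeta>)"
    by (auto intro!: derivative_eq_intros bounded_linear.has_derivative[OF bounded_linear_vector_scalar_mult])
  from has_derivative_compose[OF this holomorphic_cn_on_frechet(1)[OF assms]]
  show ?thesis
    by (simp add: has_field_derivative_def holomorphic_cn_on_frechet(2)[OF assms] mult_commute_abs)
qed

lemma slice_holomorphic:
  assumes "holomorphic_cn_on F U"
  shows "(\<lambda>\<zeta>. F (u + \<zeta> *s v)) holomorphic_on {\<zeta>. u + \<zeta> *s v \<in> U}"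
  unfolding holomorphic_on_def field_differentiable_def
  using slice_has_field_derivative[OF assms] has_field_derivative_at_within by blast

text \<open>Cauchy's inequality on the line through \<open>u\<close> in direction \<open>v\<close>. The factor \<open>2\<close> pays for using a closed
  disc of half the available radius, which avoids a limit.\<close>

lemma Cauchy_estimate_cn:
  assumes F: "holomorphic_cn_on F (ball u \<rho>)" and "0 < \<rho>"
    and bound: "\<And>x. x \<in> ball u \<rho> \<Longrightarrow> cmod (F x) \<le> B"
  shows "cmod (frechet_derivative F (at u) v) \<le> 2 * B / \<rho> * norm v"
proof (cases "v = 0")
  case True
  then show ?thesis
    using has_derivative_bounded_linear[OF holomorphic_cn_on_frechet(1)[OF F]] \<open>0 < \<rho>\<close>
    by (simp add: linear_simps)
next
  case False
  define s where "s = \<rho> / (2 * norm v)"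
  have s: "s > 0" using False \<open>0 < \<rho>\<close> by (simp add: s_def)
  have inb: "u + \<zeta> *s v \<in> ball u \<rho>" if "cmod \<zeta> \<le> s" for \<zeta>
  proof -
    have "cmod \<zeta> * norm v \<le> s * norm v" using that by (intro mult_right_mono) auto
    also have "\<dots> < \<rho>" using False \<open>0 < \<rho>\<close> by (simp add: s_def)
    finally show ?thesis by (simp add: dist_norm norm_vector_scalar_mult)
  qed
  let ?\<phi> = "\<lambda>\<zeta>. F (u + \<zeta> *s v)"
  have hol: "?\<phi> holomorphic_on cball 0 s"
    by (rule holomorphic_on_subset[OF slice_holomorphic[OF F]]) (use inb in auto)
  have "norm ((deriv ^^ 1) ?\<phi> 0) \<le> fact 1 * B / s ^ 1"
    using s by (intro Cauchy_inequality holomorphic_on_subset[OF hol] holomorphic_on_imp_continuous_on[OF hol] bound inb) auto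
  moreover have "deriv ?\<phi> 0 = frechet_derivative F (at u) v"
    using slice_has_field_derivative[OF F, of u 0 v] \<open>0 < \<rho>\<close> by (simp add: DERIV_imp_deriv)
  ultimately show ?thesis by (simp add: s_def field_simps)
qed

text \<open>Around every point of the smaller ball there is a ball of radius \<open>r / 4\<close> inside the larger one; the
  Cauchy estimate bounds the derivative there.\<close>

lemma holomorphic_cn_Lipschitz:
  assumes F: "holomorphic_cn_on F (ball z r)" and "0 < r"
    and bound: "\<And>x. x \<in> ball z r \<Longrightarrow> cmod (F x) \<le> M"
    and xy: "x \<in> cball z (3 * r / 4)" "y \<in> cball z (3 * r / 4)"
  shows "cmod (F x - F y) \<le> 8 * M / r * norm (x - y)"
proof (rule differentiable_bound[OF convex_cball _ _ xy])
  fix u assume u: "u \<in> cball z (3 * r / 4)"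
  have sub: "ball u (r / 4) \<subseteq> ball z r"
  proof
    fix x assume "x \<in> ball u (r / 4)"
    then show "x \<in> ball z r" using u dist_triangle[of z x u] by simp
  qed
  have "u \<in> ball z r" using u \<open>0 < r\<close> by auto
  then show "(F has_derivative frechet_derivative F (at u)) (at u within cball z (3 * r / 4))"
    using holomorphic_cn_on_frechet(1)[OF F] has_derivative_at_withinI by blast
  have "cmod (frechet_derivative F (at u) v) \<le> 2 * M / (r / 4) * norm v" for v
    using sub \<open>0 < r\<close>
    by (intro Cauchy_estimate_cn holomorphic_cn_on_subset[OF F] bound) auto
  then show "onorm (frechet_derivative F (at u)) \<le> 8 * M / r"
    by (intro onorm_le) (simp add: mult.commute)
qed

text \<open>The Lipschitz estimate gives equicontinuity, so Arzela--Ascoli yields a subsequence that converges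
  uniformly on the ball of radius \<open>3r/4\<close>. Applied to differences of its members, the Cauchy estimate
  shows that the derivatives are uniformly Cauchy on the ball of radius \<open>r/2\<close>. Hence the limit is
  differentiable, and complex linearity of the derivative survives the limit.\<close>

theorem Montel_cn:
  assumes F: "\<And>n. holomorphic_cn_on (F n) (ball z r)" and r: "0 < r"
    and bound: "\<And>n x. x \<in> ball z r \<Longrightarrow> cmod (F n x) \<le> M"
  obtains k G where "strict_mono (k :: nat \<Rightarrow> nat)" "holomorphic_cn_on G (ball z (r / 2))"
    "\<And>x. x \<in> ball z (r / 2) \<Longrightarrow> (\<lambda>n. F (k n) x) \<longlonglongrightarrow> G x"
proof -
  let ?S = "cball z (3 * r / 4)"
  have sub: "?S \<subseteq> ball z r" using r by auto
  have M: "0 \<le> M" using order_trans[OF norm_ge_zero bound[of z 0]] r by simp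
  have equicont: "\<exists>d>0. \<forall>n y. y \<in> ?S \<and> norm (x - y) < d \<longrightarrow> norm (F n x - F n y) < e"
    if "x \<in> ?S" "0 < e" for x e
  proof (intro exI conjI allI impI)
    \<comment> \<open>Adding \<open>1\<close> keeps the constant positive when \<open>M = 0\<close>.\<close>
    define L where "L = 8 * M / r + 1"
    have L: "L > 0" using M r by (simp add: L_def add_nonneg_pos)
    show "e / L > 0" using L that by simp
    fix n y assume y: "y \<in> ?S \<and> norm (x - y) < e / L"
    have "norm (F n x - F n y) \<le> 8 * M / r * norm (x - y)"
      using that y F by (intro holomorphic_cn_Lipschitz r bound) auto
    also have "\<dots> \<le> L * norm (x - y)" by (intro mult_right_mono) (auto simp: L_def)
    also have "\<dots> < e" using y L by (simp add: field_simps)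
    finally show "norm (F n x - F n y) < e" .
  qed
  have conv: "\<exists>g k. strict_mono (k :: nat \<Rightarrow> nat) \<and>
      (\<forall>e>0. \<exists>N. \<forall>n x. n \<ge> N \<and> x \<in> ?S \<longrightarrow> norm (F (k n) x - g x) < e)"
  proof (rule Arzela_Ascoli[of ?S F M])
    show "norm (F n x) \<le> M" if "x \<in> ?S" for n x using sub that bound by blast
    show "\<exists>d>0. \<forall>n y. y \<in> ?S \<and> norm (x - y) < d \<longrightarrow> norm (F n x - F n y) < e"
      if "x \<in> ?S" "0 < e" for x e using that by (rule equicont)
    fix g and k :: "nat \<Rightarrow> nat"
    assume "strict_mono k"
      "\<And>e. 0 < e \<Longrightarrow> \<exists>N. \<forall>n x. n \<ge> N \<and> x \<in> ?S \<longrightarrow> norm (F (k n) x - g x) < e"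
    then show ?thesis by (intro exI[of _ g] exI[of _ k] conjI allI impI)
  qed (rule compact_cball)
  from conv obtain g and k :: "nat \<Rightarrow> nat" where k: "strict_mono k"
    and unif: "\<And>e. 0 < e \<Longrightarrow> \<exists>N. \<forall>n x. n \<ge> N \<and> x \<in> ?S \<longrightarrow> norm (F (k n) x - g x) < e"
    by blast
  define D where "D n x = frechet_derivative (F (k n)) (at x)" for n x
  have Dder: "(F (k n) has_derivative D n x) (at x)" and Dlin: "D n x (c *s v) = c * D n x v"
    if "x \<in> ball z (r / 2)" for n x c v
    using holomorphic_cn_on_frechet[OF F] that r unfolding D_def by auto
  have Dcauchy: "\<exists>N. \<forall>m\<ge>N. \<forall>n\<ge>N. \<forall>x\<in>ball z (r / 2). \<forall>v. norm (D m x v - D n x v) \<le> e * norm v"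
    if "0 < e" for e
  proof -
    \<comment> \<open>The constant is chosen so that the Cauchy estimate on balls of radius \<open>r / 4\<close>, a factor \<open>8 / r\<close>,
        turns the distance \<open>e r / 8\<close> of two members into \<open>e\<close>.\<close>
    have "0 < e * r / 16" using that r by simp
    from unif[OF this]
    obtain N where N: "\<And>n x. n \<ge> N \<Longrightarrow> x \<in> ?S \<Longrightarrow> norm (F (k n) x - g x) < e * r / 16"
      by blast
    have "norm (D m x v - D n x v) \<le> e * norm v"
      if mn: "m \<ge> N" "n \<ge> N" and x: "x \<in> ball z (r / 2)" for m n x v
    proof -
      have xS: "ball x (r / 4) \<subseteq> ?S"
      proof
        fix y assume "y \<in> ball x (r / 4)"
        then show "y \<in> ?S" using x dist_triangle[of z y x] by simp
      qed
      have small: "cmod (F (k m) y - F (k n) y) \<le> e * r / 8" if "y \<in> ball x (r / 4)" for y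
        using N[OF mn(1), of y] N[OF mn(2), of y] xS that
          norm_triangle_ineq4[of "F (k m) y - g y" "F (k n) y - g y"] by fastforce
      have hol: "holomorphic_cn_on (\<lambda>y. F (k m) y - F (k n) y) (ball x (r / 4))"
        using xS sub by (intro holomorphic_cn_on_subset[OF holomorphic_cn_on_diff[OF F F]]) auto
      have "cmod (frechet_derivative (\<lambda>y. F (k m) y - F (k n) y) (at x) v)
          \<le> 2 * (e * r / 8) / (r / 4) * norm v"
        using r by (intro Cauchy_estimate_cn hol small) auto
      moreover have "frechet_derivative (\<lambda>y. F (k m) y - F (k n) y) (at x) = (\<lambda>v. D m x v - D n x v)"
        using has_derivative_diff[OF Dder[OF x, of m] Dder[OF x, of n]]
        by (rule frechet_derivative_at[symmetric])
      ultimately show ?thesis using r by simp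
    qed
    then show ?thesis by blast
  qed
  define D' where "D' x v = lim (\<lambda>n. D n x v)" for x v
  have Dlim: "(\<lambda>n. D n x v) \<longlonglongrightarrow> D' x v" if x: "x \<in> ball z (r / 2)" for x v
  proof -
    have "Cauchy (\<lambda>n. D n x v)"
    proof (rule metric_CauchyI)
      fix e :: real assume e: "0 < e"
      \<comment> \<open>The \<open>1\<close> covers \<open>v = 0\<close>.\<close>
      define c where "c = e / (norm v + 1)"
      have pos: "0 < norm v + 1" by (simp add: add_nonneg_pos)
      have c: "0 < c" "c * norm v < e"
        using e pos by (simp_all add: c_def pos_divide_less_eq)
      obtain N where "\<forall>m\<ge>N. \<forall>n\<ge>N. \<forall>x\<in>ball z (r / 2). \<forall>v. norm (D m x v - D n x v) \<le> c * norm v"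
        using Dcauchy[OF c(1)] by blast
      then show "\<exists>N. \<forall>m\<ge>N. \<forall>n\<ge>N. dist (D m x v) (D n x v) < e"
        using x c(2) unfolding dist_norm by (meson le_less_trans)
    qed
    then show ?thesis unfolding D'_def by (simp add: Cauchy_convergent_iff convergent_LIMSEQ_iff)
  qed
  have "\<exists>G. \<forall>x\<in>ball z (r / 2). (\<lambda>n. F (k n) x) \<longlonglongrightarrow> G x \<and>
      (G has_derivative D' x) (at x within ball z (r / 2))"
  proof (rule has_derivative_sequence[where ?x0.0=z])
    show "(F (k n) has_derivative D n x) (at x within ball z (r / 2))" if "x \<in> ball z (r / 2)" for n x
      using Dder[OF that] by (rule has_derivative_at_withinI)
    show "(\<lambda>n. F (k n) z) \<longlonglongrightarrow> g z"
    proof (rule LIMSEQ_I)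
      fix e :: real assume "0 < e"
      from unif[OF this] obtain N where "\<forall>n x. n \<ge> N \<and> x \<in> ?S \<longrightarrow> norm (F (k n) x - g x) < e" ..
      then show "\<exists>N. \<forall>n\<ge>N. norm (F (k n) z - g z) < e"
        using r by (intro exI[of _ N]) simp
    qed
    fix e :: real assume "0 < e"
    then obtain N where N: "\<And>m n x v. m \<ge> N \<Longrightarrow> n \<ge> N \<Longrightarrow> x \<in> ball z (r / 2) \<Longrightarrow>
        norm (D m x v - D n x v) \<le> e * norm v"
      using Dcauchy by meson
    have "norm (D n x v - D' x v) \<le> e * norm v" if "n \<ge> N" "x \<in> ball z (r / 2)" for n x v
    proof (rule Lim_norm_ubound[OF trivial_limit_sequentially])
      show "(\<lambda>m. D n x v - D m x v) \<longlonglongrightarrow> D n x v - D' x v"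
        by (intro tendsto_diff tendsto_const Dlim that)
      show "\<forall>\<^sub>F m in sequentially. norm (D n x v - D m x v) \<le> e * norm v"
        using eventually_ge_at_top[of N] by eventually_elim (use N that in auto)
    qed
    then show "\<forall>\<^sub>F n in sequentially. \<forall>x\<in>ball z (r / 2). \<forall>v. norm (D n x v - D' x v) \<le> e * norm v"
      unfolding eventually_sequentially by blast
  qed (use r in auto)
  then obtain G where G: "\<And>x. x \<in> ball z (r / 2) \<Longrightarrow> (\<lambda>n. F (k n) x) \<longlonglongrightarrow> G x"
      "\<And>x. x \<in> ball z (r / 2) \<Longrightarrow> (G has_derivative D' x) (at x within ball z (r / 2))" by blast
  have "holomorphic_cn_on G (ball z (r / 2))"
    unfolding holomorphic_cn_on_def
  proof
    fix x assume x: "x \<in> ball z (r / 2)"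
    have "(G has_derivative D' x) (at x)"
      using G(2)[OF x] unfolding at_within_open[OF x open_ball] .
    moreover have "D' x (c *s v) = c * D' x v" for c v
    proof (rule LIMSEQ_unique)
      show "(\<lambda>n. D n x (c *s v)) \<longlonglongrightarrow> D' x (c *s v)" by (rule Dlim[OF x])
      show "(\<lambda>n. D n x (c *s v)) \<longlonglongrightarrow> c * D' x v"
        unfolding Dlin[OF x] by (rule tendsto_mult_left[OF Dlim[OF x]])
    qed
    ultimately show "\<exists>D. (G has_derivative D) (at x) \<and> (\<forall>c v. D (c *s v) = c * D v)" by blast
  qed
  from that[OF k this G(1)] show ?thesis .
qed

section \<open>Locally injective plane curves\<close>

text \<open>On the compact set \<open>S\<close> the curve is a homeomorphism onto its image. If the image contained a disc,
  the inverse would embed the disc into the line, against invariance of dimension.\<close>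

lemma interior_injective_compact_curve:
  fixes c :: "real \<Rightarrow> complex"
  assumes "compact S" "continuous_on S c" "inj_on c S"
  shows "interior (c ` S) = {}"
proof (rule ccontr)
  assume ne: "interior (c ` S) \<noteq> {}"
  define g where "g = inv_into S c"
  have "continuous_on (c ` S) g"
    using assms by (intro continuous_on_inv) (auto simp: g_def)
  then have "continuous_on (interior (c ` S)) g"
    by (rule continuous_on_subset) (rule interior_subset)
  moreover have "inj_on g (interior (c ` S))"
    unfolding g_def by (meson inj_on_inv_into interior_subset)
  ultimately have "DIM(complex) \<le> DIM(real)"
    using ne by (intro invariance_of_dimension[of "interior (c ` S)" g]) auto
  then show False by simp
qed

text \<open>The constant \<open>2\<close> stands for any bound below \<open>\<pi>\<close>: the sine of the difference is then nonzero unless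
  the difference is.\<close>

lemma cis_eqD:
  assumes "cis s = cis t" "\<bar>s - t\<bar> \<le> 2"
  shows "s = t"
proof (rule ccontr)
  assume "s \<noteq> t"
  have "cis (s - t) = 1" "cis (t - s) = 1"
    using assms(1) by (auto simp: cis_divide[symmetric])
  then have "sin (s - t) = 0" "sin (t - s) = 0"
    by (auto simp: complex_eq_iff)
  moreover have "sin (s - t) > 0 \<or> sin (t - s) > 0"
    using assms(2) \<open>s \<noteq> t\<close> pi_gt3 by (cases "s < t") (auto intro!: sin_gt_zero)
  ultimately show False by simp
qed

lemma locally_injective_on_cis:
  assumes "locally_injective_on (sphere 0 1) c"
  obtains d where "0 < d" "inj_on (\<lambda>s. c (cis s)) {t - d..t + d}"
proof -
  obtain U where U: "open U" "cis t \<in> U" "inj_on c (U \<inter> sphere 0 1)"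
    using assms unfolding locally_injective_on_def by (metis mem_sphere_0 norm_cis)
  have "open (cis -` U)"
    by (rule continuous_open_vimage[OF U(1)]) (auto simp: cis_conv_exp[abs_def] intro!: continuous_intros)
  then obtain e where e: "e > 0" "cball t e \<subseteq> cis -` U"
    using U(2) unfolding open_contains_cball by blast
  \<comment> \<open>The cut-off at \<open>1\<close> keeps the interval so short that \<open>cis\<close> is injective on it.\<close>
  define d where "d = min e 1"
  have "inj_on (\<lambda>s. c (cis s)) {t - d..t + d}"
  proof (rule inj_onI)
    fix x y assume xy: "x \<in> {t - d..t + d}" "y \<in> {t - d..t + d}" "c (cis x) = c (cis y)"
    have "x \<in> cball t e" "y \<in> cball t e"
      using xy by (auto simp: d_def dist_real_def)
    then have "cis x \<in> U \<inter> sphere 0 1" "cis y \<in> U \<inter> sphere 0 1" using e by auto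
    then have "cis x = cis y" using U(3) xy(3) by (meson inj_onD)
    then show "x = y" by (rule cis_eqD) (use xy in \<open>auto simp: d_def\<close>)
  qed
  moreover have "0 < d" using e by (simp add: d_def)
  ultimately show ?thesis using that by blast
qed

lemma sphere_eq_cis_image: "sphere 0 1 = cis ` {0..2 * pi}"
proof (intro equalityI subsetI)
  fix z :: complex assume "z \<in> sphere 0 1"
  then have z: "norm z = 1" by simp
  then have "z = cis (Arg2pi z)"
    using Arg2pi_eq[of z] by (simp add: cis_conv_exp mult.commute)
  moreover have "Arg2pi z \<in> {0..2 * pi}"
    using Arg2pi_ge_0[of z] Arg2pi_lt_2pi[of z] by simp
  ultimately show "z \<in> cis ` {0..2 * pi}" by blast
qed auto

lemma interior_Union_finite_closed:
  fixes A :: "'i \<Rightarrow> 'a::topological_space set"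
  assumes "finite I" "\<And>i. i \<in> I \<Longrightarrow> closed (A i)" "\<And>i. i \<in> I \<Longrightarrow> interior (A i) = {}"
  shows "interior (\<Union>i\<in>I. A i) = {}"
  using assms
proof (induction I)
  case (insert i I)
  then show ?case
    using interior_closed_Un_empty_interior[of "A i" "\<Union>i\<in>I. A i"] by simp
qed simp

text \<open>By compactness the curve is a finite union of closed arcs, each with empty interior.\<close>

lemma interior_locally_injective_curve:
  assumes cont: "continuous_on UNIV (\<lambda>t. c (cis t))"
    and inj: "locally_injective_on (sphere 0 1) (c :: complex \<Rightarrow> complex)"
  shows "interior (c ` sphere 0 1) = {}"
proof -
  have "\<forall>t. \<exists>d>0. inj_on (\<lambda>s. c (cis s)) {t - d..t + d}"
    using locally_injective_on_cis[OF inj] by metis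
  then obtain d where d: "\<And>t. d t > 0" "\<And>t. inj_on (\<lambda>s. c (cis s)) {t - d t..t + d t}" by metis
  obtain I where I: "I \<subseteq> {0..2 * pi}" "finite I" "{0..2 * pi} \<subseteq> (\<Union>t\<in>I. ball t (d t))"
    by (rule compactE_image[of "{0..2 * pi}" "{0..2 * pi}" "\<lambda>t. ball t (d t)"]) (use d in auto)
  let ?A = "\<lambda>t. (\<lambda>s. c (cis s)) ` {t - d t..t + d t}"
  have "interior (\<Union>t\<in>I. ?A t) = {}"
  proof (rule interior_Union_finite_closed[OF I(2)])
    show "closed (?A t)" for t
      by (intro compact_imp_closed compact_continuous_image continuous_on_subset[OF cont]) auto
    show "interior (?A t) = {}" for t
      by (intro interior_injective_compact_curve d continuous_on_subset[OF cont]) auto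
  qed
  moreover have "c ` sphere 0 1 \<subseteq> (\<Union>t\<in>I. ?A t)"
  proof -
    have "\<exists>t\<in>I. s \<in> {t - d t..t + d t}" if "s \<in> {0..2 * pi}" for s
      using that I(3) by (force simp: dist_real_def)
    then show ?thesis unfolding sphere_eq_cis_image by blast
  qed
  ultimately show ?thesis using interior_mono by blast
qed

text \<open>Parameters close to \<open>t\<close> give curve points close to \<open>c (cis t)\<close>, and local injectivity makes them
  different from it.\<close>

lemma locally_injective_curve_islimpt:
  assumes cont: "continuous_on UNIV (\<lambda>t. c (cis t))"
    and inj: "locally_injective_on (sphere 0 1) c"
    and r: "0 < r"
  shows "c (cis t) islimpt (c ` sphere 0 1 \<inter> ball (c (cis t)) r)"
proof (rule islimptI)
  fix T assume T: "c (cis t) \<in> T" "open T"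
  obtain d where d: "0 < d" "inj_on (\<lambda>s. c (cis s)) {t - d..t + d}"
    using locally_injective_on_cis[OF inj] by blast
  have "open ((\<lambda>s. c (cis s)) -` (T \<inter> ball (c (cis t)) r))"
    using T by (intro continuous_open_vimage) (auto simp: cont[unfolded continuous_on_eq_continuous_at[OF open_UNIV]])
  moreover have "t \<in> (\<lambda>s. c (cis s)) -` (T \<inter> ball (c (cis t)) r)" using T r by simp
  ultimately obtain e where e: "e > 0" "cball t e \<subseteq> (\<lambda>s. c (cis s)) -` (T \<inter> ball (c (cis t)) r)"
    unfolding open_contains_cball by blast
  define s where "s = t + min d e"
  have "s \<in> cball t e" "s \<in> {t - d..t + d}" "s \<noteq> t"
    using d(1) e(1) by (auto simp: s_def dist_real_def)
  moreover from this have "c (cis s) \<noteq> c (cis t)"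
    using inj_onD[OF d(2), of s t] d(1) by auto
  ultimately show "\<exists>y\<in>c ` sphere 0 1 \<inter> ball (c (cis t)) r. y \<in> T \<and> y \<noteq> c (cis t)"
    using e(2) by (intro bexI[of _ "c (cis s)"]) auto
qed

section \<open>Extensions to balls\<close>

text \<open>Extensions with a prescribed radius and a prescribed bound, so that sequences of them are subject to
  compactness.\<close>

definition bounded_extension ::
    "(complex ^ 'n::finite) set \<Rightarrow> complex ^ 'n \<Rightarrow> real \<Rightarrow> real \<Rightarrow> (complex ^ 'n \<Rightarrow> complex) \<Rightarrow> bool" where
  "bounded_extension K z r M f \<longleftrightarrow>
     (\<exists>F. holomorphic_cn_on F (ball z r) \<and> (\<forall>u\<in>ball z r. cmod (F u) \<le> M) \<and>
       (\<forall>u\<in>ball z r \<inter> K. F u = f u))"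

lemma hol_extendable_at_iff_bounded_extension:
  "hol_extendable_at K f z \<longleftrightarrow> (\<exists>k::nat. bounded_extension K z (1 / Suc k) (Suc k) f)"
proof
  assume "hol_extendable_at K f z"
  then obtain U F where U: "open U" "z \<in> U" "holomorphic_cn_on F U" "\<forall>u\<in>U \<inter> K. F u = f u"
    unfolding hol_extendable_at_def by blast
  obtain r where r: "r > 0" "cball z r \<subseteq> U" using U open_contains_cball by blast
  have "compact (F ` cball z r)"
    using holomorphic_cn_on_continuous_on[OF U(3)] r
    by (intro compact_continuous_image) (auto intro: continuous_on_subset)
  then obtain M where M: "\<And>u. u \<in> cball z r \<Longrightarrow> cmod (F u) \<le> M"
    by (meson bounded_iff compact_imp_bounded image_eqI)
  \<comment> \<open>One index serves as inverse radius and as bound.\<close>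
  obtain k :: nat where k: "max (1 / r) M < k" using reals_Archimedean2 by blast
  have "1 / Suc k \<le> r" using k r by (simp add: field_simps)
  then have sub: "ball z (1 / Suc k) \<subseteq> cball z r" by auto
  have "bounded_extension K z (1 / Suc k) (Suc k) f"
    unfolding bounded_extension_def
  proof (intro exI conjI ballI)
    show "holomorphic_cn_on F (ball z (1 / Suc k))"
      using holomorphic_cn_on_subset[OF U(3)] sub r by blast
    show "cmod (F u) \<le> Suc k" if "u \<in> ball z (1 / Suc k)" for u
      using M[of u] sub that k by fastforce
    show "F u = f u" if "u \<in> ball z (1 / Suc k) \<inter> K" for u
      using U(4) sub r that by blast
  qed
  then show "\<exists>k::nat. bounded_extension K z (1 / Suc k) (Suc k) f" ..
next
  assume "\<exists>k::nat. bounded_extension K z (1 / Suc k) (Suc k) f"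
  then obtain k :: nat and F where "holomorphic_cn_on F (ball z (1 / Suc k))"
    "\<forall>u\<in>ball z (1 / Suc k) \<inter> K. F u = f u"
    unfolding bounded_extension_def by blast
  then show "hol_extendable_at K f z"
    unfolding hol_extendable_at_def by (intro exI[of _ "ball z (1 / Suc k)"] exI[of _ F]) auto
qed

text \<open>Pointwise convergence on \<open>K\<close> suffices, since compactness is applied to the extensions. Halving the
  radius is the price for uniform estimates of their derivatives.\<close>

lemma bounded_extension_limit:
  assumes ext: "\<And>n::nat. bounded_extension K z r M (f n)" and "0 < r"
    and lim: "\<And>u. u \<in> K \<Longrightarrow> (\<lambda>n. f n u) \<longlonglongrightarrow> g u"
  shows "bounded_extension K z (r / 2) M g"
proof -
  obtain F where F: "\<And>n. holomorphic_cn_on (F n) (ball z r)"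
    "\<And>n u. u \<in> ball z r \<Longrightarrow> cmod (F n u) \<le> M" "\<And>n u. u \<in> ball z r \<inter> K \<Longrightarrow> F n u = f n u"
    using ext unfolding bounded_extension_def by metis
  have "\<exists>k G. strict_mono (k :: nat \<Rightarrow> nat) \<and> holomorphic_cn_on G (ball z (r / 2)) \<and>
      (\<forall>x\<in>ball z (r / 2). (\<lambda>n. F (k n) x) \<longlonglongrightarrow> G x)"
    by (rule Montel_cn[of F, OF F(1) \<open>0 < r\<close> F(2)]) blast+
  then obtain k G where G: "strict_mono (k :: nat \<Rightarrow> nat)" "holomorphic_cn_on G (ball z (r / 2))"
    "\<And>x. x \<in> ball z (r / 2) \<Longrightarrow> (\<lambda>n. F (k n) x) \<longlonglongrightarrow> G x"
    by blast
  have sub: "ball z (r / 2) \<subseteq> ball z r" using \<open>0 < r\<close> by auto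
  show ?thesis
    unfolding bounded_extension_def
  proof (intro exI conjI ballI)
    show "holomorphic_cn_on G (ball z (r / 2))" by (rule G)
    show "cmod (G u) \<le> M" if u: "u \<in> ball z (r / 2)" for u
      using sub u by (intro Lim_norm_ubound[OF trivial_limit_sequentially G(3)[OF u]] always_eventually allI F(2)) auto
    show "G u = g u" if u: "u \<in> ball z (r / 2) \<inter> K" for u
    proof (rule LIMSEQ_unique)
      show "(\<lambda>n. F (k n) u) \<longlonglongrightarrow> G u" using G(3) u by blast
      have "(\<lambda>n. f (k n) u) \<longlonglongrightarrow> g u"
        using LIMSEQ_subseq_LIMSEQ[OF lim G(1)] u by (simp add: o_def)
      then show "(\<lambda>n. F (k n) u) \<longlonglongrightarrow> g u" using F(3) u sub by auto
    qed
  qed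
qed

text \<open>Two functions that differ by a simple pole inside the ball cannot both extend to it. Everything
  happens on the line through \<open>z\<close> parallel to the \<open>i\<close>-th axis, which meets \<open>K\<close> in the \<open>i\<close>-th curve.\<close>

lemma no_extension_of_pole:
  fixes \<gamma> :: "'n::finite \<Rightarrow> complex \<Rightarrow> complex" and i :: 'n
  assumes cont: "continuous_on UNIV (\<lambda>t. \<gamma> i (cis t))"
    and inj: "locally_injective_on (sphere 0 1) (\<gamma> i)"
    and z: "z \<in> curve_image \<gamma>" and r: "0 < r"
    and w: "w \<in> ball (z $ i) r" "w \<notin> \<gamma> i ` sphere 0 1"
    and f: "bounded_extension (curve_image \<gamma>) z r M f"
    and g: "bounded_extension (curve_image \<gamma>) z r M' g"
    and gf: "\<And>u. u \<in> curve_image \<gamma> \<Longrightarrow> g u = f u + a / (u $ i - w)"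
  shows "a = 0"
proof -
  obtain F G where F: "holomorphic_cn_on F (ball z r)" "\<And>u. u \<in> ball z r \<inter> curve_image \<gamma> \<Longrightarrow> F u = f u"
    and G: "holomorphic_cn_on G (ball z r)" "\<And>u. u \<in> ball z r \<inter> curve_image \<gamma> \<Longrightarrow> G u = g u"
  proof -
    obtain F where "holomorphic_cn_on F (ball z r)" "\<forall>u\<in>ball z r \<inter> curve_image \<gamma>. F u = f u"
      using f unfolding bounded_extension_def by blast
    moreover obtain G where "holomorphic_cn_on G (ball z r)" "\<forall>u\<in>ball z r \<inter> curve_image \<gamma>. G u = g u"
      using g unfolding bounded_extension_def by blast
    ultimately show ?thesis using that by blast
  qed
  obtain x where x: "x \<in> torus" "z = prod_curve \<gamma> x" using z by (auto simp: curve_image_def)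
  obtain t where t: "x $ i = cis t"
    using x(1) sphere_eq_cis_image by (auto simp: torus_def)
  have zi: "z $ i = \<gamma> i (cis t)" by (simp add: x t prod_curve_def)
  \<comment> \<open>\<open>L \<zeta>\<close> is \<open>z\<close> with its \<open>i\<close>-th coordinate replaced by \<open>\<zeta>\<close>.\<close>
  define L :: "complex \<Rightarrow> complex ^ 'n" where "L \<zeta> = (z - z $ i *s axis i 1) + \<zeta> *s axis i 1" for \<zeta>
  have L_eq: "L \<zeta> - z = (\<zeta> - z $ i) *s axis i 1" for \<zeta>
    by (simp add: L_def vec_eq_iff algebra_simps)
  have L_ball: "L \<zeta> \<in> ball z r" if "\<zeta> \<in> ball (z $ i) r" for \<zeta>
  proof -
    have "dist (L \<zeta>) z = dist \<zeta> (z $ i)"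
      unfolding dist_norm L_eq norm_vector_scalar_mult by simp
    then show ?thesis using that by (simp add: dist_commute)
  qed
  have L_curve: "L (\<gamma> i y) \<in> curve_image \<gamma>" if "y \<in> sphere 0 1" for y
  proof -
    have "L (\<gamma> i y) = prod_curve \<gamma> (\<chi> j. if j = i then y else x $ j)"
      by (auto simp: L_def x prod_curve_def vec_eq_iff axis_def)
    moreover have "(\<chi> j. if j = i then y else x $ j) \<in> torus"
      using that x(1) by (auto simp: torus_def)
    ultimately show ?thesis by (auto simp: curve_image_def)
  qed
  have Li: "L \<zeta> $ i = \<zeta>" for \<zeta> by (simp add: L_def)
  \<comment> \<open>Vanishes on the \<open>i\<close>-th curve near \<open>z\<^sub>i\<close>, but has the value \<open>- a\<close> at \<open>w\<close>.\<close>
  define \<phi> where "\<phi> \<zeta> = (G (L \<zeta>) - F (L \<zeta>)) * (\<zeta> - w) - a" for \<zeta>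
  have "\<phi> holomorphic_on ball (z $ i) r"
    unfolding \<phi>_def L_def
    by (intro holomorphic_intros holomorphic_on_subset[OF slice_holomorphic[OF F(1)]]
        holomorphic_on_subset[OF slice_holomorphic[OF G(1)]])
      (use L_ball in \<open>auto simp: L_def\<close>)
  moreover have "\<phi> \<zeta> = 0" if \<zeta>: "\<zeta> \<in> \<gamma> i ` sphere 0 1 \<inter> ball (z $ i) r" for \<zeta>
  proof -
    have "L \<zeta> \<in> ball z r \<inter> curve_image \<gamma>" using \<zeta> L_ball L_curve by auto
    moreover have "\<zeta> \<noteq> w" using \<zeta> w by auto
    ultimately show ?thesis using F(2) G(2) gf[of "L \<zeta>"] by (simp add: \<phi>_def Li)
  qed
  moreover have "z $ i islimpt (\<gamma> i ` sphere 0 1 \<inter> ball (z $ i) r)"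
    unfolding zi by (rule locally_injective_curve_islimpt[OF cont inj r])
  ultimately have "\<phi> w = 0"
    using w r by (intro analytic_continuation[of \<phi> "ball (z $ i) r" "\<gamma> i ` sphere 0 1 \<inter> ball (z $ i) r" "z $ i" w]) auto
  then show ?thesis by (simp add: \<phi>_def)
qed

section \<open>Adding a pole\<close>

text \<open>The line through \<open>f\<close> in direction \<open>h\<close>; real parameters are enough to leave a point.\<close>

definition perturbation ::
    "('n::finite \<Rightarrow> complex \<Rightarrow> complex) \<Rightarrow> (complex ^ 'n \<Rightarrow> complex) \<Rightarrow> (complex ^ 'n \<Rightarrow> complex) \<Rightarrow>
      real \<Rightarrow> complex ^ 'n \<Rightarrow> complex" where
  "perturbation \<gamma> f h a = restrict (\<lambda>u. f u + of_real a * h u) (curve_image \<gamma>)"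

lemma pullback_perturbation:
  "pullback \<gamma> (perturbation \<gamma> f h a) = (\<lambda>\<theta>. pullback \<gamma> f \<theta> + of_real a * pullback \<gamma> h \<theta>)"
  unfolding perturbation_def pullback_restrict by (simp add: pullback_def)

lemma perturbation_in_C_space:
  assumes "f \<in> C_space p \<gamma>" "h \<in> C_space p \<gamma>"
  shows "perturbation \<gamma> f h a \<in> C_space p \<gamma>"
proof -
  have "C_class (enat n) (\<lambda>\<theta>. pullback \<gamma> f \<theta> + of_real a * pullback \<gamma> h \<theta>)" if "enat n \<le> p" for n
    using assms C_class_mono[OF _ that]
    by (intro C_class_add C_class_mult C_class_const) (auto simp: in_C_space_iff)
  then have "C_class p (pullback \<gamma> (perturbation \<gamma> f h a))"
    unfolding pullback_perturbation using C_class_iff_finite_orders by blast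
  then show ?thesis by (simp add: in_C_space_iff perturbation_def)
qed

lemma jet_perturbation:
  assumes "f \<in> C_space p \<gamma>" "h \<in> C_space p \<gamma>" "w \<in> words p"
  shows "jet \<gamma> (perturbation \<gamma> f h a) w = jet \<gamma> f w + a *\<^sub>R jet \<gamma> h w"
proof (rule bcontfun_eqI)
  fix \<theta>
  have "iter_partial w (pullback \<gamma> (perturbation \<gamma> f h a)) =
      (\<lambda>\<theta>. iter_partial w (pullback \<gamma> f) \<theta> + of_real a * iter_partial w (pullback \<gamma> h) \<theta>)"
    unfolding pullback_perturbation using assms
    by (intro iter_partial_add_mult[of p]) (auto simp: in_C_space_iff words_def)
  then show "jet \<gamma> (perturbation \<gamma> f h a) w \<theta> = (jet \<gamma> f w + a *\<^sub>R jet \<gamma> h w) \<theta>"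
    unfolding plus_bcontfun.rep_eq scaleR_bcontfun.rep_eq
      apply_jet[OF perturbation_in_C_space[OF assms(1,2)] assms(3)]
      apply_jet[OF assms(1,3)] apply_jet[OF assms(2,3)]
    by (simp add: scaleR_conv_of_real)
qed

text \<open>The jets depend affinely on \<open>a\<close>, so a line through a point of \<open>C\<^sup>p(\<gamma>)\<close> does not leave an open set at
  once.\<close>

lemma continuous_map_perturbation:
  assumes "f \<in> C_space p \<gamma>" "h \<in> C_space p \<gamma>"
  shows "continuous_map euclidean (C_topology p \<gamma>) (perturbation \<gamma> f h)"
  unfolding C_topology_eq_jet_balls
proof (rule continuous_on_generated_topo)
  show "perturbation \<gamma> f h ` topspace euclidean \<subseteq>
      \<Union> {{g \<in> C_space p \<gamma>. dist (jet \<gamma> g w) (jet \<gamma> f w) < \<epsilon>} | f w \<epsilon>.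
        f \<in> C_space p \<gamma> \<and> w \<in> words p \<and> 0 < \<epsilon>}"
  proof -
    have "range (perturbation \<gamma> f h) \<subseteq> topspace (C_topology p \<gamma>)"
      unfolding topspace_C_topology using perturbation_in_C_space[OF assms] by (rule image_subsetI)
    then show ?thesis
      unfolding C_topology_eq_jet_balls topology_generated_by_topspace topspace_euclidean .
  qed
  fix U assume "U \<in> {{g \<in> C_space p \<gamma>. dist (jet \<gamma> g w) (jet \<gamma> f w) < \<epsilon>} | f w \<epsilon>.
        f \<in> C_space p \<gamma> \<and> w \<in> words p \<and> 0 < \<epsilon>}"
  then obtain f' w \<epsilon> where w: "w \<in> words p"
    and U: "U = {g \<in> C_space p \<gamma>. dist (jet \<gamma> g w) (jet \<gamma> f' w) < \<epsilon>}" by blast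
  have "perturbation \<gamma> f h -` U = {a. dist (jet \<gamma> f w + a *\<^sub>R jet \<gamma> h w) (jet \<gamma> f' w) < \<epsilon>}"
    unfolding U using perturbation_in_C_space[OF assms] jet_perturbation[OF assms w] by auto
  moreover have "open {a. dist (jet \<gamma> f w + a *\<^sub>R jet \<gamma> h w) (jet \<gamma> f' w) < \<epsilon>}"
    by (intro open_Collect_less continuous_intros)
  ultimately show "openin euclidean (perturbation \<gamma> f h -` U \<inter> topspace euclidean)" by simp
qed

text \<open>The denominator has no zero on \<open>K\<close>, so the reciprocal is as smooth as the curve.\<close>

lemma pole_in_C_space:
  assumes "C_circle p (\<gamma> i)" "w \<notin> \<gamma> i ` sphere 0 1"
  shows "restrict (\<lambda>u. inverse (u $ i - w)) (curve_image \<gamma>) \<in> C_space p \<gamma>"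
proof -
  have "C_class (enat n) (\<lambda>\<theta> :: real ^ 'a. inverse (\<gamma> i (cis (\<theta> $ i)) + - w))" if "enat n \<le> p" for n
  proof (rule C_class_inverse)
    have "C_class (enat n) (\<lambda>t. \<gamma> i (cis t))"
      using assms(1) that C_class_mono by (auto simp: C_circle_def)
    then show "C_class (enat n) (\<lambda>\<theta> :: real ^ 'a. \<gamma> i (cis (\<theta> $ i)) + - w)"
      by (intro C_class_add C_class_const C_class_coordinate)
    show "\<gamma> i (cis (\<theta> $ i)) + - w \<noteq> 0" for \<theta> :: "real ^ 'a"
      using assms(2) by (metis add.right_inverse add_right_cancel image_eqI mem_sphere_0 norm_cis)
  qed
  then have "C_class p (pullback \<gamma> (\<lambda>u. inverse (u $ i - w)))"
    by (subst C_class_iff_finite_orders) (simp add: pullback_def prod_curve_def torus_exp_def)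
  then show ?thesis by (simp add: in_C_space_iff)
qed

lemma C_circle_continuous: "C_circle p c \<Longrightarrow> continuous_on UNIV (\<lambda>t. c (cis t))"
  by (simp add: C_circle_def C_class_continuous)

section \<open>Generic non-extendability\<close>

text \<open>Balls of radius \<open>1/n\<close> in the seminorm of order zero supply a sequence in the set that converges
  uniformly on \<open>K\<close> to the given closure point.\<close>

lemma closure_of_bounded_extensions:
  assumes "0 < r"
  shows "C_topology p \<gamma> closure_of {f \<in> C_space p \<gamma>. bounded_extension (curve_image \<gamma>) z r M f}
     \<subseteq> {f \<in> C_space p \<gamma>. bounded_extension (curve_image \<gamma>) z (r / 2) M f}"
proof
  let ?E = "{f \<in> C_space p \<gamma>. bounded_extension (curve_image \<gamma>) z r M f}"
  fix f assume f: "f \<in> C_topology p \<gamma> closure_of ?E"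
  then have fC: "f \<in> C_space p \<gamma>" by (simp add: in_closure_of topspace_C_topology)
  have "\<forall>n. \<exists>g. g \<in> ?E \<and> dist (jet \<gamma> g []) (jet \<gamma> f []) < 1 / Suc n"
  proof
    fix n
    let ?T = "{g \<in> C_space p \<gamma>. dist (jet \<gamma> g []) (jet \<gamma> f []) < 1 / Suc n}"
    have "f \<in> ?T" using fC by simp
    moreover have "openin (C_topology p \<gamma>) ?T" by (intro openin_jet_ball fC) auto
    ultimately have "\<exists>g. g \<in> ?E \<and> g \<in> ?T"
      using in_closure_of[THEN iffD1, OF f, THEN conjunct2, THEN spec, of ?T] by (simp only: simp_thms)
    then show "\<exists>g. g \<in> ?E \<and> dist (jet \<gamma> g []) (jet \<gamma> f []) < 1 / Suc n"
      unfolding mem_Collect_eq by (elim exE conjE) (intro exI conjI)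
  qed
  then obtain g where g: "\<And>n. g n \<in> ?E" "\<And>n. dist (jet \<gamma> (g n) []) (jet \<gamma> f []) < 1 / Suc n"
    by (auto dest!: choice)
  have "(\<lambda>n. jet \<gamma> (g n) []) \<longlonglongrightarrow> jet \<gamma> f []"
  proof (rule metric_LIMSEQ_I)
    fix e :: real assume "0 < e"
    then obtain N where "inverse (real (Suc N)) < e" using reals_Archimedean by blast
    then have "dist (jet \<gamma> (g n) []) (jet \<gamma> f []) < e" if "n \<ge> N" for n
      using g(2)[of n] inverse_of_nat_le[of "Suc N" "Suc n", where 'a=real] that
      by (simp add: inverse_eq_divide)
    then show "\<exists>N. \<forall>n\<ge>N. dist (jet \<gamma> (g n) []) (jet \<gamma> f []) < e" by blast
  qed
  from tendsto_bcontfun_uniform_limit[OF this]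
  have lim: "(\<lambda>n. jet \<gamma> (g n) [] \<theta>) \<longlonglongrightarrow> jet \<gamma> f [] \<theta>" for \<theta>
    by (rule tendsto_uniform_limitI) simp
  have "bounded_extension (curve_image \<gamma>) z (r / 2) M f"
  proof (rule bounded_extension_limit[OF _ assms])
    show "bounded_extension (curve_image \<gamma>) z r M (g n)" for n using g(1) by blast
    have gC: "g n \<in> C_space p \<gamma>" for n using g(1) by blast
    show "(\<lambda>n. g n u) \<longlonglongrightarrow> f u" if "u \<in> curve_image \<gamma>" for u
      using that lim unfolding jet_Nil_apply[OF gC] jet_Nil_apply[OF fC] by (auto simp: curve_image_eq)
  qed
  then show "f \<in> {f \<in> C_space p \<gamma>. bounded_extension (curve_image \<gamma>) z (r / 2) M f}"
    using fC by simp
qed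

text \<open>An interior point \<open>f\<close> could be moved a little along the direction of a pole \<open>w\<close> in the ball and off
  the curve, which \<open>no_extension_of_pole\<close> forbids. Any coordinate \<open>i\<close> serves.\<close>

lemma interior_of_bounded_extensions:
  fixes \<gamma> :: "'n::finite \<Rightarrow> complex \<Rightarrow> complex"
  assumes \<gamma>: "\<And>i. C_circle p (\<gamma> i)" "\<And>i. locally_injective_on (sphere 0 1) (\<gamma> i)"
    and z: "z \<in> curve_image \<gamma>" and r: "0 < r"
  shows "C_topology p \<gamma> interior_of {f \<in> C_space p \<gamma>. bounded_extension (curve_image \<gamma>) z r M f} = {}"
proof (rule ccontr)
  let ?E = "{f \<in> C_space p \<gamma>. bounded_extension (curve_image \<gamma>) z r M f}"
  assume "C_topology p \<gamma> interior_of ?E \<noteq> {}"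
  then obtain f V where V: "openin (C_topology p \<gamma>) V" "f \<in> V" "V \<subseteq> ?E"
    unfolding interior_of_def by auto
  define i :: 'n where "i = undefined"
  have cont: "continuous_on UNIV (\<lambda>t. \<gamma> i (cis t))" using \<gamma>(1) by (rule C_circle_continuous)
  have "\<not> ball (z $ i) r \<subseteq> \<gamma> i ` sphere 0 1"
    using interior_locally_injective_curve[OF cont \<gamma>(2)] interior_maximal[of "ball (z $ i) r"] r
    by (metis ball_eq_empty linorder_not_less open_ball subset_empty)
  then obtain w where w: "w \<in> ball (z $ i) r" "w \<notin> \<gamma> i ` sphere 0 1" by blast
  define h where "h = restrict (\<lambda>u. inverse (u $ i - w)) (curve_image \<gamma>)"
  have h: "h \<in> C_space p \<gamma>" unfolding h_def by (rule pole_in_C_space[of p \<gamma> i w, OF \<gamma>(1) w(2)])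
  have f: "f \<in> C_space p \<gamma>" "bounded_extension (curve_image \<gamma>) z r M f" using V by auto
  have "open (perturbation \<gamma> f h -` V)"
    using continuous_map_perturbation[OF f(1) h] V(1) unfolding continuous_map_def
    by (auto simp: vimage_def)
  moreover have "0 \<in> perturbation \<gamma> f h -` V"
  proof -
    have "perturbation \<gamma> f h 0 = f"
      using f(1) by (auto simp: perturbation_def in_C_space_iff extensional_def fun_eq_iff)
    then show ?thesis using V(2) by simp
  qed
  ultimately obtain e where e: "e > 0" "cball 0 e \<subseteq> perturbation \<gamma> f h -` V"
    unfolding open_contains_cball by blast
  have "e \<in> cball 0 e" using e(1) by simp
  then have "perturbation \<gamma> f h e \<in> V" using e(2) by blast
  then have "bounded_extension (curve_image \<gamma>) z r M (perturbation \<gamma> f h e)" using V(3) by blast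
  from no_extension_of_pole[where \<gamma>=\<gamma> and i=i and a="of_real e", OF cont \<gamma>(2) z r w f(2) this]
  have "complex_of_real e = 0"
    by (simp add: perturbation_def h_def divide_inverse)
  then show False using e by simp
qed

lemma bounded_extension_imp_hol_extendable_at:
  assumes "bounded_extension K z r M f" "0 < r"
  shows "hol_extendable_at K f z"
  using assms unfolding bounded_extension_def hol_extendable_at_def
  by (meson centre_in_ball open_ball)

lemma dense_gdelta_in_Inter_open_dense:
  assumes "completely_metrizable_space X" "countable \<U>" "\<U> \<noteq> {}"
    and "\<And>U. U \<in> \<U> \<Longrightarrow> openin X U \<and> X closure_of U = topspace X"
  shows "dense_gdelta_in X (\<Inter> \<U>)"
  unfolding dense_gdelta_in_def
proof
  show "gdelta_in X (\<Inter> \<U>)"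
    using assms by (intro gdelta_in_Inter open_imp_gdelta_in) auto
  show "X closure_of \<Inter> \<U> = topspace X"
    using assms by (intro Baire_category) auto
qed

text \<open>Exhibiting the open dense sets themselves, and not merely a dense intersection, lets the families
  for different points be merged before Baire's theorem is applied.\<close>

theorem non_extendable_at_open_dense_family:
  fixes \<gamma> :: "'n::finite \<Rightarrow> complex \<Rightarrow> complex"
  assumes \<gamma>: "\<And>i. C_circle p (\<gamma> i)" "\<And>i. locally_injective_on (sphere 0 1) (\<gamma> i)"
    and z: "z \<in> curve_image \<gamma>"
  shows "\<exists>\<U>. countable \<U> \<and> \<U> \<noteq> {} \<and>
    (\<forall>U\<in>\<U>. openin (C_topology p \<gamma>) U \<and> C_topology p \<gamma> closure_of U = topspace (C_topology p \<gamma>)) \<and>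
    {f \<in> C_space p \<gamma>. \<not> hol_extendable_at (curve_image \<gamma>) f z} = \<Inter> \<U>"
proof -
  let ?X = "C_topology p \<gamma>" and ?K = "curve_image \<gamma>"
  define E where "E k = ?X closure_of {f \<in> C_space p \<gamma>. bounded_extension ?K z (1 / Suc k) (Suc k) f}" for k :: nat
  define \<U> where "\<U> = range (\<lambda>k. topspace ?X - E k)"
  have E: "E k \<subseteq> {f \<in> C_space p \<gamma>. bounded_extension ?K z (1 / Suc k / 2) (Suc k) f}" for k
    unfolding E_def by (rule closure_of_bounded_extensions) simp
  have "?X interior_of E k = {}" for k
  proof -
    have "?X interior_of E k
        \<subseteq> ?X interior_of {f \<in> C_space p \<gamma>. bounded_extension ?K z (1 / Suc k / 2) (Suc k) f}"
      by (rule interior_of_mono[OF E])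
    also have "\<dots> = {}"
      by (rule interior_of_bounded_extensions[OF \<gamma> z]) simp
    finally show ?thesis by blast
  qed
  then have "openin ?X U \<and> ?X closure_of U = topspace ?X" if "U \<in> \<U>" for U
    using that by (auto simp: \<U>_def E_def closure_of_complement)
  moreover have "{f \<in> C_space p \<gamma>. \<not> hol_extendable_at ?K f z} = \<Inter> \<U>"
  proof -
    have "hol_extendable_at ?K f z \<longleftrightarrow> (\<exists>k. f \<in> E k)" if f: "f \<in> C_space p \<gamma>" for f
    proof
      assume "hol_extendable_at ?K f z"
      then obtain k :: nat where "bounded_extension ?K z (1 / Suc k) (Suc k) f"
        unfolding hol_extendable_at_iff_bounded_extension by blast
      then have "f \<in> E k"
        unfolding E_def using f
        by (intro subsetD[OF closure_of_subset]) (auto simp: topspace_C_topology)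
      then show "\<exists>k. f \<in> E k" ..
    next
      assume "\<exists>k. f \<in> E k"
      then obtain k where "bounded_extension ?K z (1 / Suc k / 2) (Suc k) f" using E by blast
      then show "hol_extendable_at ?K f z"
        by (rule bounded_extension_imp_hol_extendable_at) simp
    qed
    then show ?thesis by (auto simp: \<U>_def topspace_C_topology)
  qed
  moreover have "countable \<U>" "\<U> \<noteq> {}" by (auto simp: \<U>_def)
  ultimately show ?thesis by (intro exI[of _ \<U>]) simp
qed

theorem theorem17:
  fixes p :: enat and \<gamma> :: "'n::finite \<Rightarrow> complex \<Rightarrow> complex"
  assumes "\<And>i. C_circle p (\<gamma> i)"
    and "\<And>i. locally_injective_on (sphere 0 1) (\<gamma> i)"
  shows "(\<forall>z\<in>curve_image \<gamma>. dense_gdelta_in (C_topology p \<gamma>)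
            {f \<in> C_space p \<gamma>. \<not> hol_extendable_at (curve_image \<gamma>) f z}) \<and>
         dense_gdelta_in (C_topology p \<gamma>)
            {f \<in> C_space p \<gamma>. \<forall>z\<in>curve_image \<gamma>. \<not> hol_extendable_at (curve_image \<gamma>) f z}"
proof -
  let ?X = "C_topology p \<gamma>" and ?K = "curve_image \<gamma>"
  let ?N = "\<lambda>z. {f \<in> C_space p \<gamma>. \<not> hol_extendable_at ?K f z}"
  have "\<forall>z\<in>?K. \<exists>\<U>. countable \<U> \<and> \<U> \<noteq> {} \<and>
      (\<forall>U\<in>\<U>. openin ?X U \<and> ?X closure_of U = topspace ?X) \<and> ?N z = \<Inter> \<U>"
    by (rule ballI) (rule non_extendable_at_open_dense_family[where \<gamma>=\<gamma>, OF assms])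
  from bchoice[OF this] obtain \<U> where "\<forall>z\<in>?K. countable (\<U> z) \<and> \<U> z \<noteq> {} \<and>
      (\<forall>U\<in>\<U> z. openin ?X U \<and> ?X closure_of U = topspace ?X) \<and> ?N z = \<Inter> (\<U> z)" ..
  then have \<U>: "countable (\<U> z)" "\<U> z \<noteq> {}"
    "\<And>U. U \<in> \<U> z \<Longrightarrow> openin ?X U \<and> ?X closure_of U = topspace ?X" "?N z = \<Inter> (\<U> z)"
    if "z \<in> ?K" for z
    using that by (simp_all only: Ball_def simp_thms)
  note dense = dense_gdelta_in_Inter_open_dense[OF completely_metrizable_C_topology]
  have "dense_gdelta_in ?X (?N z)" if "z \<in> ?K" for z
    unfolding \<U>(4)[OF that] using \<U>(1-3)[OF that] by (rule dense)
  moreover have "dense_gdelta_in ?X {f \<in> C_space p \<gamma>. \<forall>z\<in>?K. \<not> hol_extendable_at ?K f z}"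
  proof -
    obtain D where D: "countable D" "D \<subseteq> ?K" "?K \<subseteq> closure D" by (rule separable)
    have "?K \<noteq> {}" by (simp add: curve_image_eq)
    then have "D \<noteq> {}" using D(3) by auto
    \<comment> \<open>An extension at \<open>z\<close> is an extension at every point of \<open>K\<close> in its domain.\<close>
    have spread: "\<exists>d\<in>D. hol_extendable_at ?K f d"
      if z: "z \<in> ?K" and ext: "hol_extendable_at ?K f z" for f z
    proof -
      obtain U F where U: "open U" "z \<in> U" "holomorphic_cn_on F U" "\<forall>u\<in>U \<inter> ?K. F u = f u"
        using ext unfolding hol_extendable_at_def by blast
      have "U \<inter> closure D \<noteq> {}" using U(2) z D(3) by blast
      then obtain d where "d \<in> D" "d \<in> U" using open_Int_closure_eq_empty[OF U(1)] by blast
      then show ?thesis using U unfolding hol_extendable_at_def by blast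
    qed
    have "{f \<in> C_space p \<gamma>. \<forall>z\<in>?K. \<not> hol_extendable_at ?K f z} = (\<Inter>z\<in>D. ?N z)"
      using spread D(2) \<open>D \<noteq> {}\<close> by blast
    also have "\<dots> = (\<Inter>z\<in>D. \<Inter> (\<U> z))"
      using \<U>(4) D(2) by (intro INF_cong) auto
    also have "\<dots> = \<Inter> (\<Union>z\<in>D. \<U> z)" by blast
    finally have eq: "{f \<in> C_space p \<gamma>. \<forall>z\<in>?K. \<not> hol_extendable_at ?K f z} = \<Inter> (\<Union>z\<in>D. \<U> z)" .
    show ?thesis
      unfolding eq
    proof (rule dense)
      show "countable (\<Union>z\<in>D. \<U> z)" using D \<U>(1) by blast
      show "(\<Union>z\<in>D. \<U> z) \<noteq> {}" using \<open>D \<noteq> {}\<close> D(2) \<U>(2) by blast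
      show "openin ?X U \<and> ?X closure_of U = topspace ?X" if "U \<in> (\<Union>z\<in>D. \<U> z)" for U
        using that D(2) \<U>(3) by blast
    qed
  qed
  ultimately show ?thesis by blast
qed

end
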